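(* Let $G$ be a connected strongly regular graph. Then its strong regularity, the vector of parameters $(n,d,\lambda,\mu)$, the Lovász $\vartheta$-function $\vartheta(G)$, the number of edges, the number of triangles, the girth, and the diameter are all determined by the adjacency spectrum of $G$. That is, every graph $H$ whose adjacency matrix has the same multiset of eigenvalues as that of $G$ is strongly regular with the same parameters $(n,d,\lambda,\mu)$ as $G$, and has the same Lovász $\vartheta$-function value, number of edges, number of triangles, girth, and diameter as $G$.
   Context: All graphs are finite, simple and undirected. A regular graph that is neither complete nor empty is strongly regular with parameters $(n,d,\lambda,\mu)$ if it is $d$-regular on $n$ vertices, every two adjacent vertices have exactly $\lambda$ common neighbors, and every two distinct nonadjacent vertices have exactly $\mu$ common neighbors. The Lovász $\vartheta$-function is $\vartheta(G) = \min_{c,\{u_i\}} \max_{i\in V(G)} \frac{1}{(c^{T}u_i)^2}$, where the minimum is over all unit vectors $c$ and all assignments of unit real vectors $u_i$ to vertices such that $u_i^{T}u_j=0$ whenever $i\ne j$ are nonadjacent. The girth is the length of a shortest cycle; the diameter is the maximum distance between two vertices (infinite for a disconnected graph). *)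

theory Defs
  imports
    "Jordan_Normal_Form.Char_Poly"
    "Graph_Theory.Graph_Theory"
    "HOL-Library.Extended_Nat"
    "HOL-Library.Extended_Real"
begin

text \<open>
  A finite simple undirected graph is a \<open>pair_graph\<close>: a finite vertex set together with an
  irreflexive symmetric relation \<open>parcs\<close>, in which each edge \<open>{u, v}\<close> occurs as the two
  arcs \<open>(u, v)\<close> and \<open>(v, u)\<close>.
\<close>

definition nbrs :: "'a pair_pre_digraph \<Rightarrow> 'a \<Rightarrow> 'a set" where
  "nbrs G v = {u. (v, u) \<in> parcs G}"

definition complete_graph :: "'a pair_pre_digraph \<Rightarrow> bool" where
  "complete_graph G \<longleftrightarrow> (\<forall>u\<in>pverts G. \<forall>v\<in>pverts G. u \<noteq> v \<longrightarrow> (u, v) \<in> parcs G)"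

definition empty_graph :: "'a pair_pre_digraph \<Rightarrow> bool" where
  "empty_graph G \<longleftrightarrow> parcs G = {}"

definition strongly_regular ::
    "'a pair_pre_digraph \<Rightarrow> nat \<Rightarrow> nat \<Rightarrow> nat \<Rightarrow> nat \<Rightarrow> bool" where
  "strongly_regular G n d lam mu \<longleftrightarrow>
     \<not> complete_graph G \<and> \<not> empty_graph G \<and>
     card (pverts G) = n \<and>
     (\<forall>v\<in>pverts G. card (nbrs G v) = d) \<and>
     (\<forall>u\<in>pverts G. \<forall>v\<in>pverts G. (u, v) \<in> parcs G \<longrightarrow> card (nbrs G u \<inter> nbrs G v) = lam) \<and>
     (\<forall>u\<in>pverts G. \<forall>v\<in>pverts G. u \<noteq> v \<and> (u, v) \<notin> parcs G \<longrightarrow>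
        card (nbrs G u \<inter> nbrs G v) = mu)"

definition adj_mat :: "'a list \<Rightarrow> 'a pair_pre_digraph \<Rightarrow> complex mat" where
  "adj_mat vs G = mat (length vs) (length vs)
     (\<lambda>(i, j). if (vs ! i, vs ! j) \<in> parcs G then 1 else 0)"

text \<open>
  The eigenvalues with their algebraic multiplicities. Over \<open>complex\<close> the multiset has exactly
  as many elements as the graph has vertices; as the matrix is real symmetric, all of them are
  real and the algebraic and geometric multiplicities agree. The enumeration of the vertices is
  irrelevant, see \<open>adj_spectrum_eq\<close> below.
\<close>

definition adj_spectrum :: "'a pair_pre_digraph \<Rightarrow> complex multiset" where
  "adj_spectrum G =
     proots (char_poly (adj_mat (SOME vs. distinct vs \<and> set vs = pverts G) G))"

text \<open>Unit vectors in \<open>k\<close>-dimensional space, orthogonal for distinct nonadjacent vertices.\<close>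

definition orthonormal_rep :: "'a pair_pre_digraph \<Rightarrow> nat \<Rightarrow> ('a \<Rightarrow> real vec) \<Rightarrow> bool" where
  "orthonormal_rep G k u \<longleftrightarrow>
     (\<forall>i\<in>pverts G. u i \<in> carrier_vec k \<and> scalar_prod (u i) (u i) = 1) \<and>
     (\<forall>i\<in>pverts G. \<forall>j\<in>pverts G. i \<noteq> j \<and> (i, j) \<notin> parcs G \<longrightarrow> scalar_prod (u i) (u j) = 0)"

text \<open>
  The value is extended real because \<open>c\<close> may be orthogonal to some \<open>u i\<close>; in \<open>ereal\<close> the
  quotient \<open>1 / 0\<close> is \<open>\<infinity>\<close>. The dimension \<open>k\<close> is arbitrary. The minimum is written as an
  infimum; by compactness it is attained (in dimension at most the number of vertices plus one).
\<close>

definition lovasz_theta :: "'a pair_pre_digraph \<Rightarrow> ereal" where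
  "lovasz_theta G =
     Inf {(MAX i\<in>pverts G. 1 / ereal ((scalar_prod c (u i))\<^sup>2)) | k c u.
            c \<in> carrier_vec k \<and> scalar_prod c c = 1 \<and> orthonormal_rep G k u}"

definition num_edges :: "'a pair_pre_digraph \<Rightarrow> nat" where
  "num_edges G = card {{u, v} | u v. (u, v) \<in> parcs G}"

definition num_triangles :: "'a pair_pre_digraph \<Rightarrow> nat" where
  "num_triangles G =
     card {{u, v, w} | u v w. (u, v) \<in> parcs G \<and> (v, w) \<in> parcs G \<and> (u, w) \<in> parcs G}"

text \<open>
  The library notion \<open>cycle\<close> also admits going back and forth along one edge, hence the bound on
  the length. An acyclic graph has girth \<open>\<infinity>\<close>.
\<close>

definition girth :: "'a pair_pre_digraph \<Rightarrow> enat" where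
  "girth G = (INF p \<in> {p. pre_digraph.cycle (with_proj G) p \<and> 3 \<le> length p}. enat (length p))"

text \<open>With all arcs of weight 1, \<open>\<mu>\<close> is the distance, and is \<open>\<infinity>\<close> between components.\<close>

definition graph_dist :: "'a pair_pre_digraph \<Rightarrow> 'a \<Rightarrow> 'a \<Rightarrow> ereal" where
  "graph_dist G u v = wf_digraph.\<mu> (with_proj G) (\<lambda>_. 1) u v"

definition diam :: "'a pair_pre_digraph \<Rightarrow> ereal" where
  "diam G = (SUP u\<in>pverts G. SUP v\<in>pverts G. graph_dist G u v)"

lemma char_poly_adj_mat_reorder:
  assumes "distinct vs" "distinct ws" "set vs = set ws"
  shows "char_poly (adj_mat vs G) = char_poly (adj_mat ws G)"
proof -
  define n where "n = length vs"
  have n': "length ws = n"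
    using assms by (metis distinct_card n_def)
  define P :: "complex mat" where "P = mat n n (\<lambda>(i, j). if vs ! i = ws ! j then 1 else 0)"
  define Q :: "complex mat" where "Q = mat n n (\<lambda>(i, j). if ws ! i = vs ! j then 1 else 0)"
  have ex_ws: "\<exists>k<n. ws ! k = vs ! i" if "i < n" for i
    using that assms n' n_def by (metis in_set_conv_nth)
  have ex_vs: "\<exists>k<n. vs ! k = ws ! i" if "i < n" for i
    using that assms n' n_def by (metis in_set_conv_nth)
  have inj_ws: "ws ! k = ws ! l \<longleftrightarrow> k = l" if "k < n" "l < n" for k l
    using that assms n' by (simp add: nth_eq_iff_index_eq)
  have inj_vs: "vs ! k = vs ! l \<longleftrightarrow> k = l" if "k < n" "l < n" for k l
    using that assms n_def by (simp add: nth_eq_iff_index_eq)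
  have sumL: "(\<Sum>k = 0..<n. (if a = ws ! k then 1 else 0) * f k) = (f l :: complex)"
    if "l < n" "ws ! l = a" for a l f
  proof -
    have "(\<Sum>k = 0..<n. (if a = ws ! k then 1 else 0) * f k) = (\<Sum>k = 0..<n. if l = k then f k else 0)"
      using that inj_ws by (intro sum.cong) auto
    then show ?thesis using that by simp
  qed
  have sumL': "(\<Sum>k = 0..<n. (if a = vs ! k then 1 else 0) * f k) = (f l :: complex)"
    if "l < n" "vs ! l = a" for a l f
  proof -
    have "(\<Sum>k = 0..<n. (if a = vs ! k then 1 else 0) * f k) = (\<Sum>k = 0..<n. if l = k then f k else 0)"
      using that inj_vs by (intro sum.cong) auto
    then show ?thesis using that by simp
  qed
  have sumR: "(\<Sum>k = 0..<n. f k * (if ws ! k = a then 1 else 0)) = (f l :: complex)"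
    if "l < n" "ws ! l = a" for a l f
  proof -
    have "(\<Sum>k = 0..<n. f k * (if ws ! k = a then 1 else 0)) = (\<Sum>k = 0..<n. if l = k then f k else 0)"
      using that inj_ws by (intro sum.cong) auto
    then show ?thesis using that by simp
  qed
  have PQ: "P * Q = 1\<^sub>m n"
  proof (rule eq_matI)
    fix i j assume "i < dim_row (1\<^sub>m n)" "j < dim_col (1\<^sub>m n)"
    then have ij: "i < n" "j < n" by auto
    obtain l where l: "l < n" "ws ! l = vs ! i" using ex_ws ij by blast
    show "(P * Q) $$ (i, j) = (1\<^sub>m n :: complex mat) $$ (i, j)"
      using ij l by (simp add: P_def Q_def scalar_prod_def sumL[OF l] inj_vs)
  qed (simp_all add: P_def Q_def)
  have QP: "Q * P = 1\<^sub>m n"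
  proof (rule eq_matI)
    fix i j assume "i < dim_row (1\<^sub>m n)" "j < dim_col (1\<^sub>m n)"
    then have ij: "i < n" "j < n" by auto
    obtain l where l: "l < n" "vs ! l = ws ! i" using ex_vs ij by blast
    show "(Q * P) $$ (i, j) = (1\<^sub>m n :: complex mat) $$ (i, j)"
      using ij l by (simp add: P_def Q_def scalar_prod_def sumL'[OF l] inj_ws)
  qed (simp_all add: P_def Q_def)
  have PA: "P * adj_mat ws G = mat n n (\<lambda>(i, j). if (vs ! i, ws ! j) \<in> parcs G then 1 else 0)"
  proof (rule eq_matI)
    fix i j assume "i < dim_row (mat n n (\<lambda>(i, j). if (vs ! i, ws ! j) \<in> parcs G then 1 else 0) :: complex mat)"
      "j < dim_col (mat n n (\<lambda>(i, j). if (vs ! i, ws ! j) \<in> parcs G then 1 else 0) :: complex mat)"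
    then have ij: "i < n" "j < n" by auto
    obtain l where l: "l < n" "ws ! l = vs ! i" using ex_ws ij by blast
    show "(P * adj_mat ws G) $$ (i, j) =
        (mat n n (\<lambda>(i, j). if (vs ! i, ws ! j) \<in> parcs G then 1 else 0)) $$ (i, j)"
      using ij l n' by (simp add: P_def adj_mat_def scalar_prod_def sumL[OF l])
  qed (simp_all add: P_def adj_mat_def n')
  have "P * adj_mat ws G * Q = adj_mat vs G"
    unfolding PA
  proof (rule eq_matI)
    fix i j assume "i < dim_row (adj_mat vs G)" "j < dim_col (adj_mat vs G)"
    then have ij: "i < n" "j < n" by (auto simp: adj_mat_def n_def)
    obtain l where l: "l < n" "ws ! l = vs ! j" using ex_ws ij by blast
    show "(mat n n (\<lambda>(i, j). if (vs ! i, ws ! j) \<in> parcs G then 1 else 0) * Q) $$ (i, j) =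
        adj_mat vs G $$ (i, j)"
      using ij l by (simp add: Q_def adj_mat_def scalar_prod_def n_def[symmetric] sumR[OF l])
  qed (simp_all add: Q_def adj_mat_def n_def)
  then have "similar_mat (adj_mat vs G) (adj_mat ws G)"
    unfolding similar_mat_def similar_mat_wit_def Let_def
    using PQ QP by (intro exI[of _ P] exI[of _ Q]) (auto simp: adj_mat_def P_def Q_def n_def n')
  then show ?thesis by (rule char_poly_similar)
qed

lemma adj_spectrum_eq:
  assumes "distinct vs" "set vs = pverts G"
  shows "adj_spectrum G = proots (char_poly (adj_mat vs G))"
proof -
  let ?P = "\<lambda>vs. distinct vs \<and> set vs = pverts G"
  have "?P (SOME vs. ?P vs)" using assms by (intro someI[of ?P vs]) simp
  then show ?thesis
    unfolding adj_spectrum_def using assms by (metis char_poly_adj_mat_reorder)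
qed

end

theory Submission
  imports Defs "Jordan_Normal_Form.Schur_Decomposition"
begin

text \<open>
  The traces of \<open>A\<^sup>2\<close>, \<open>A\<^sup>3\<close>, \<open>A\<^sup>4\<close> are determined by the spectrum. The sum of the squared entries of
  \<open>A\<^sup>2 - (lam - mu) A - (d - mu) I - mu J\<close> depends only on these traces and on the sum \<open>S\<close> of the
  squared degrees, and it decreases in \<open>S\<close>. It vanishes for \<open>G\<close>, where \<open>S\<close> is minimal given the numbers
  of vertices and edges, because \<open>G\<close> is regular. Hence it vanishes for \<open>H\<close>, which is thus strongly regular.

  All the other invariants are functions of \<open>(n, d, lam, mu)\<close> as soon as \<open>mu > 0\<close>. Writing \<open>r \<ge> 0 > s\<close> for
  the eigenvalues other than \<open>d\<close>, the value of \<open>\<vartheta>\<close> is \<open>- s n / (d - s) = (n - d + r) / (1 + r)\<close>: a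
  representation with Gram matrix \<open>I - A / s\<close> attains it, and the positive semidefinite matrix
  \<open>r I - A + J\<close>, whose entries on edges are zero, is a dual certificate.
\<close>

subsection \<open>Traces of powers\<close>

text \<open>In the sum for entry \<open>(i, j)\<close>, terms with \<open>k < i\<close> vanish
  because of \<open>A\<close> and those with \<open>j < k\<close> because of \<open>B\<close>. For
  \<open>j < i\<close> this covers every \<open>k\<close>; for \<open>j = i\<close> only
  \<open>k = i\<close> survives.\<close>

lemma upper_triangular_mult_diag:
  fixes A B :: "'a :: comm_ring_1 mat"
  assumes A: "A \<in> carrier_mat n n" "upper_triangular A"
    and B: "B \<in> carrier_mat n n" "upper_triangular B"
  shows "upper_triangular (A * B)"
    and "i < n \<Longrightarrow> (A * B) $$ (i, i) = A $$ (i, i) * B $$ (i, i)"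
proof -
  have zero: "A $$ (i, k) * B $$ (k, j) = 0" if "i < n" "k < n" "j < n" "k < i \<or> j < k" for i j k
  proof (cases "k < i")
    case True
    then have "A $$ (i, k) = 0" using A that by (intro upper_triangularD) auto
    then show ?thesis by simp
  next
    case False
    then have "B $$ (k, j) = 0" using B that by (intro upper_triangularD) auto
    then show ?thesis by simp
  qed
  have entry: "(A * B) $$ (i, j) = (\<Sum>k = 0..<n. A $$ (i, k) * B $$ (k, j))" if "i < n" "j < n" for i j
    using A B that by (simp add: scalar_prod_def)
  show "upper_triangular (A * B)"
  proof
    fix i j assume ij: "j < i" "i < dim_row (A * B)"
    then have "i < n" "j < n" using A by auto
    then show "(A * B) $$ (i, j) = 0"
      unfolding entry[OF \<open>i < n\<close> \<open>j < n\<close>]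
    proof (intro sum.neutral ballI)
      fix k assume "k \<in> {0..<n}"
      then have "k < n" "k < i \<or> j < k" using ij by auto
      then show "A $$ (i, k) * B $$ (k, j) = 0" using zero \<open>i < n\<close> \<open>j < n\<close> by blast
    qed
  qed
  show "(A * B) $$ (i, i) = A $$ (i, i) * B $$ (i, i)" if i: "i < n"
  proof -
    have "(A * B) $$ (i, i) = (\<Sum>k \<in> {i}. A $$ (i, k) * B $$ (k, i))"
      unfolding entry[OF i i]
    proof (rule sum.mono_neutral_right)
      show "\<forall>k\<in>{0..<n} - {i}. A $$ (i, k) * B $$ (k, i) = 0"
      proof
        fix k assume "k \<in> {0..<n} - {i}"
        then have "k < n" "k < i \<or> i < k" by auto
        then show "A $$ (i, k) * B $$ (k, i) = 0" using zero i by blast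
      qed
    qed (use i in auto)
    then show ?thesis by simp
  qed
qed

lemma upper_triangular_pow_diag:
  fixes A :: "'a :: comm_ring_1 mat"
  assumes A: "A \<in> carrier_mat n n" "upper_triangular A"
  shows "upper_triangular (A ^\<^sub>m k) \<and> (\<forall>i<n. (A ^\<^sub>m k) $$ (i, i) = A $$ (i, i) ^ k)"
proof (induction k)
  case (Suc k)
  have car: "A ^\<^sub>m k \<in> carrier_mat n n" using A by simp
  show ?case
    using Suc upper_triangular_mult_diag[OF car _ A] by (simp add: mult.commute)
qed (use A in auto)

lemma sum_diag_mult_commute:
  fixes A B :: "'a :: comm_ring_1 mat"
  assumes "A \<in> carrier_mat n m" "B \<in> carrier_mat m n"
  shows "(\<Sum>i<n. (A * B) $$ (i, i)) = (\<Sum>i<m. (B * A) $$ (i, i))"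
proof -
  have "(\<Sum>i<n. (A * B) $$ (i, i)) = (\<Sum>i<n. \<Sum>k<m. A $$ (i, k) * B $$ (k, i))"
    using assms by (intro sum.cong) (auto simp: scalar_prod_def atLeast0LessThan)
  also have "\<dots> = (\<Sum>k<m. \<Sum>i<n. B $$ (k, i) * A $$ (i, k))"
    by (subst sum.swap) (simp add: mult.commute)
  also have "\<dots> = (\<Sum>i<m. (B * A) $$ (i, i))"
    using assms by (intro sum.cong) (auto simp: scalar_prod_def atLeast0LessThan)
  finally show ?thesis .
qed

text \<open>Schur triangularization makes \<open>A\<close> similar to a triangular \<open>B\<close>
  whose diagonal lists the roots of the characteristic polynomial with multiplicity. The trace is
  invariant under similarity, and the diagonal of a power of \<open>B\<close> consists of
  powers.\<close>

lemma trace_pow_eq_sum_proots: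
  fixes A :: "complex mat"
  assumes A: "A \<in> carrier_mat n n"
  shows "(\<Sum>i<n. (A ^\<^sub>m k) $$ (i, i)) = (\<Sum>x\<in>#proots (char_poly A). x ^ k)"
    and "size (proots (char_poly A)) = n"
proof -
  obtain es where es: "char_poly A = (\<Prod>e\<leftarrow>es. [:- e, 1:])"
    using char_poly_factorized[OF A] by blast
  obtain B where B: "B \<in> carrier_mat n n" "upper_triangular B" and sim: "similar_mat A B"
    using schur_decomposition_exists[OF A es] by blast
  have proots: "proots (\<Prod>e\<leftarrow>xs. [:- e, 1:]) = mset xs" for xs :: "complex list"
  proof (induction xs)
    case (Cons a xs)
    have "(\<Prod>e\<leftarrow>xs. [:- e, 1:]) \<noteq> 0" by (auto simp: prod_list_zero_iff)
    then have "proots ([:- a, 1:] * (\<Prod>e\<leftarrow>xs. [:- e, 1:])) = add_mset a (mset xs)"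
      using Cons by (subst proots_mult) auto
    then show ?case by (simp only: list.map prod_list.Cons mset.simps)
  qed simp
  have "proots (char_poly A) = mset (diag_mat B)"
    using char_poly_similar[OF sim] char_poly_upper_triangular[OF B] proots by metis
  moreover have "diag_mat B = map (\<lambda>i. B $$ (i, i)) [0..<n]"
    using B by (simp add: diag_mat_def)
  ultimately have P: "proots (char_poly A) = image_mset (\<lambda>i. B $$ (i, i)) (mset_set {..<n})"
    by (simp only: mset_map mset_upt atLeast0LessThan)
  then show "size (proots (char_poly A)) = n" by simp
  obtain P Q where wit: "similar_mat_wit A B P Q"
    using sim unfolding similar_mat_def by blast
  have PQ: "Q * P = 1\<^sub>m n" "P \<in> carrier_mat n n" "Q \<in> carrier_mat n n"
    using similar_mat_witD2[OF A wit] by auto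
  have Bk: "B ^\<^sub>m k \<in> carrier_mat n n" using B by simp
  have "A ^\<^sub>m k = P * B ^\<^sub>m k * Q"
    using similar_mat_witD2(3)[OF _ similar_mat_wit_pow[OF wit]] A by auto
  \<comment> \<open>Cyclicity of the trace moves \<open>Q\<close> to the front, where it cancels
    against \<open>P\<close>.\<close>
  then have "(\<Sum>i<n. (A ^\<^sub>m k) $$ (i, i)) = (\<Sum>i<n. (Q * (P * B ^\<^sub>m k)) $$ (i, i))"
    using PQ Bk sum_diag_mult_commute[of "P * B ^\<^sub>m k" n n Q] by simp
  also have "Q * (P * B ^\<^sub>m k) = B ^\<^sub>m k"
    using assoc_mult_mat[OF PQ(3,2) Bk] left_mult_one_mat[OF Bk] PQ(1) by (simp only:)
  also have "(\<Sum>i<n. (B ^\<^sub>m k) $$ (i, i)) = (\<Sum>i<n. (B $$ (i, i)) ^ k)"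
    using upper_triangular_pow_diag[OF B] by simp
  also have "\<dots> = (\<Sum>x\<in>#proots (char_poly A). x ^ k)"
    unfolding P by (simp add: sum_unfold_sum_mset image_mset.compositionality comp_def)
  finally show "(\<Sum>i<n. (A ^\<^sub>m k) $$ (i, i)) = (\<Sum>x\<in>#proots (char_poly A). x ^ k)" .
qed

section \<open>Spectral moments as sums over vertices\<close>

definition adj :: "'a pair_pre_digraph \<Rightarrow> 'a \<Rightarrow> 'a \<Rightarrow> real" where
  "adj G u v = of_bool ((u, v) \<in> parcs G)"

text \<open>In a \<open>pair_graph\<close> these are the entries of the square of the adjacency
  matrix, with the degrees on the diagonal.\<close>

definition common :: "'a pair_pre_digraph \<Rightarrow> 'a \<Rightarrow> 'a \<Rightarrow> real" where
  "common G u v = real (card (nbrs G u \<inter> nbrs G v))"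

text \<open>A bridge from complex matrices, where the spectrum lives, to real functions indexed by
  vertices: products become sums over vertices, free of the enumeration.\<close>

definition real_mat :: "'a list \<Rightarrow> ('a \<Rightarrow> 'a \<Rightarrow> real) \<Rightarrow> complex mat" where
  "real_mat vs f = mat (length vs) (length vs) (\<lambda>(i, j). of_real (f (vs ! i) (vs ! j)))"

text \<open>In a \<open>pair_graph\<close> the power sum is the trace of a power of a 0/1 matrix and
  so already real; \<open>Re\<close> only changes the type.\<close>

definition moment :: "'a pair_pre_digraph \<Rightarrow> nat \<Rightarrow> real" where
  "moment G k = Re (\<Sum>x\<in>#adj_spectrum G. x ^ k)"

lemma sum_nth_distinct:
  assumes "distinct vs"
  shows "(\<Sum>k<length vs. f (vs ! k)) = (\<Sum>v\<in>set vs. f v)"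
  unfolding sum_list_distinct_conv_sum_set[OF assms, symmetric]
  by (simp add: sum_list_sum_nth atLeast0LessThan)

lemma real_mat_mult:
  assumes "distinct vs"
  shows "real_mat vs f * real_mat vs g = real_mat vs (\<lambda>u v. \<Sum>w\<in>set vs. f u w * g w v)"
  using sum_nth_distinct[OF assms]
  by (intro eq_matI) (auto simp: real_mat_def scalar_prod_def atLeast0LessThan simp flip: of_real_mult of_real_sum)

lemma sum_diag_real_mat:
  assumes "distinct vs"
  shows "(\<Sum>i<length vs. real_mat vs f $$ (i, i)) = of_real (\<Sum>v\<in>set vs. f v v)"
  using sum_nth_distinct[OF assms, of "\<lambda>v. f v v"] by (simp add: real_mat_def flip: of_real_sum)

lemma sum_of_bool_eq:
  fixes f :: "'a \<Rightarrow> 'b :: semiring_1"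
  assumes "finite V" "u \<in> V"
  shows "(\<Sum>k\<in>V. of_bool (u = k) * f k) = f u" "(\<Sum>k\<in>V. of_bool (k = u) * f k) = f u"
proof -
  have "(\<Sum>k\<in>V. of_bool (u = k) * f k) = (\<Sum>k\<in>V. if k = u then f k else 0)"
    "(\<Sum>k\<in>V. of_bool (k = u) * f k) = (\<Sum>k\<in>V. if k = u then f k else 0)"
    by (auto intro!: sum.cong)
  then show "(\<Sum>k\<in>V. of_bool (u = k) * f k) = f u" "(\<Sum>k\<in>V. of_bool (k = u) * f k) = f u"
    using assms by simp_all
qed

context pair_graph
begin

lemma finite_pverts [simp]: "finite (pverts G)" by (rule pair_finite_verts)

lemma nbrs_subset: "nbrs G u \<subseteq> pverts G - {u}"
  unfolding nbrs_def using in_arcsD2 no_loops' by blast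

lemma finite_nbrs [simp]: "finite (nbrs G u)"
  using nbrs_subset finite_subset[OF _ finite_pverts] by blast

lemma arc_sym: "(u, v) \<in> parcs G \<longleftrightarrow> (v, u) \<in> parcs G"
  using pair_sym_arcs unfolding symmetric_def by (auto elim: symE)

lemma adj_sym: "adj G u v = adj G v u"
  by (simp add: adj_def arc_sym[of u v])

lemma adj_self [simp]: "adj G v v = 0"
  using no_loops' by (auto simp: adj_def)

lemma common_sym: "common G u v = common G v u"
  by (simp add: common_def Int_commute)

lemma sum_adj: "(\<Sum>v\<in>pverts G. adj G u v) = real (card (nbrs G u))"
proof -
  have "pverts G \<inter> nbrs G u = nbrs G u" using nbrs_subset by blast
  then show ?thesis by (simp add: adj_def sum.If_cases of_bool_def flip: nbrs_def)
qed

lemma sum_adj_adj: "(\<Sum>w\<in>pverts G. adj G u w * adj G w v) = common G u v"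
proof -
  have "pverts G \<inter> (nbrs G u \<inter> nbrs G v) = nbrs G u \<inter> nbrs G v" using nbrs_subset by blast
  moreover have "adj G u w * adj G w v = (if w \<in> nbrs G u \<inter> nbrs G v then 1 else 0)" for w
    by (auto simp: adj_def nbrs_def arc_sym[of w v])
  ultimately show ?thesis by (simp add: sum.If_cases common_def Int_assoc Collect_conj_eq)
qed

lemma spectrum_moments:
  "size (adj_spectrum G) = card (pverts G)"
  "moment G 2 = (\<Sum>v\<in>pverts G. common G v v)"
  "moment G 3 = (\<Sum>u\<in>pverts G. \<Sum>v\<in>pverts G. common G u v * adj G v u)"
  "moment G 4 = (\<Sum>u\<in>pverts G. \<Sum>v\<in>pverts G. common G u v * common G v u)"
proof -
  obtain vs where vs: "distinct vs" "set vs = pverts G"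
    using finite_distinct_list[OF finite_pverts] by blast
  define M where "M = adj_mat vs G"
  have M: "M \<in> carrier_mat (length vs) (length vs)" by (simp add: M_def adj_mat_def)
  have M1: "M = real_mat vs (adj G)"
    unfolding M_def adj_mat_def real_mat_def adj_def by (intro eq_matI) auto
  have M2: "M ^\<^sub>m 2 = real_mat vs (common G)"
    using M by (simp add: numeral_2_eq_2 M1 real_mat_mult[OF vs(1)] vs(2) sum_adj_adj)
  have "M ^\<^sub>m 3 = M ^\<^sub>m 2 * M" using M by (simp add: numeral_3_eq_3 numeral_2_eq_2)
  then have M3: "M ^\<^sub>m 3 = real_mat vs (\<lambda>u v. \<Sum>w\<in>pverts G. common G u w * adj G w v)"
    by (simp only: M2) (simp only: M1 real_mat_mult[OF vs(1)] vs(2))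
  \<comment> \<open>Regrouped as the square of \<open>M ^\<^sub>m 2\<close>, so that the entries
    involve \<open>common\<close> alone.\<close>
  have "M ^\<^sub>m 4 = M ^\<^sub>m 2 * M * M" by (simp add: eval_nat_numeral)
  also have "\<dots> = M ^\<^sub>m 2 * (M * M)" using M by (intro assoc_mult_mat) auto
  also have "M * M = M ^\<^sub>m 2" using M by (simp add: numeral_2_eq_2)
  finally have M4: "M ^\<^sub>m 4 = real_mat vs (\<lambda>u v. \<Sum>w\<in>pverts G. common G u w * common G w v)"
    by (simp add: M2 real_mat_mult[OF vs(1)] vs(2))
  have spec: "adj_spectrum G = proots (char_poly M)"
    using adj_spectrum_eq[OF vs] by (simp add: M_def)
  have mom: "moment G k = Re (\<Sum>i<length vs. (M ^\<^sub>m k) $$ (i, i))" for k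
    by (simp add: moment_def spec trace_pow_eq_sum_proots[OF M])
  show "size (adj_spectrum G) = card (pverts G)"
    using trace_pow_eq_sum_proots(2)[OF M] vs by (simp add: spec flip: distinct_card)
  show "moment G 2 = (\<Sum>v\<in>pverts G. common G v v)"
    by (simp add: mom M2 sum_diag_real_mat[OF vs(1)] vs(2))
  show "moment G 3 = (\<Sum>u\<in>pverts G. \<Sum>v\<in>pverts G. common G u v * adj G v u)"
    by (simp add: mom M3 sum_diag_real_mat[OF vs(1)] vs(2))
  show "moment G 4 = (\<Sum>u\<in>pverts G. \<Sum>v\<in>pverts G. common G u v * common G v u)"
    by (simp add: mom M4 sum_diag_real_mat[OF vs(1)] vs(2))
qed

lemma common_self: "common G v v = real (card (nbrs G v))"
  by (simp add: common_def)

text \<open>Both sides count walks of length two: by their ends on the left, by their middle vertex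
  on the right.\<close>

lemma sum_common: "(\<Sum>u\<in>pverts G. \<Sum>v\<in>pverts G. common G u v) = (\<Sum>v\<in>pverts G. (common G v v)\<^sup>2)"
proof -
  have "(\<Sum>u\<in>pverts G. \<Sum>v\<in>pverts G. common G u v)
      = (\<Sum>u\<in>pverts G. \<Sum>w\<in>pverts G. \<Sum>v\<in>pverts G. adj G u w * adj G w v)"
    unfolding sum_adj_adj[symmetric] by (intro sum.cong refl sum.swap)
  also have "\<dots> = (\<Sum>w\<in>pverts G. \<Sum>u\<in>pverts G. \<Sum>v\<in>pverts G. adj G u w * adj G w v)"
    by (rule sum.swap)
  also have "\<dots> = (\<Sum>w\<in>pverts G. (\<Sum>u\<in>pverts G. adj G w u) * (\<Sum>v\<in>pverts G. adj G w v))"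
    by (intro sum.cong refl) (simp add: sum_product adj_sym)
  finally show ?thesis by (simp add: sum_adj common_self power2_eq_square)
qed

text \<open>The left side is the squared Frobenius norm of \<open>A^2 - e A - f I - m J\<close>.
  Products among \<open>A^2\<close>, \<open>A\<close> and \<open>I\<close> give moments; the product
  of \<open>J\<close> with \<open>A^2\<close> counts walks of length two, which by
  \<open>sum_common\<close> is the one term not fixed by the moments and the number of
  vertices.\<close>

lemma sum_square_defect:
  "(\<Sum>u\<in>pverts G. \<Sum>v\<in>pverts G. (common G u v - e * adj G u v - f * of_bool (u = v) - m)\<^sup>2)
    = moment G 4 - 2 * e * moment G 3 + (e\<^sup>2 - 2 * f + 2 * e * m) * moment G 2
      + (f\<^sup>2 + 2 * f * m) * card (pverts G) + m\<^sup>2 * (card (pverts G))\<^sup>2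
      - 2 * m * (\<Sum>v\<in>pverts G. (common G v v)\<^sup>2)"
proof -
  have sq: "adj G u v * adj G u v = adj G u v" "adj G u v * of_bool (u = v) = 0" for u v
    by (auto simp: adj_def no_loops')
  \<comment> \<open>The swapped arguments in \<open>common G v u\<close> and
    \<open>adj G v u\<close> match the trace formulas of \<open>spectrum_moments\<close>.\<close>
  have "(common G u v - e * adj G u v - f * of_bool (u = v) - m)\<^sup>2
     = common G u v * common G v u - 2 * e * (common G u v * adj G v u)
      + (e\<^sup>2 + 2 * e * m) * adj G u v + (of_bool (u = v) * (f\<^sup>2 + 2 * f * m - 2 * f * common G u v))
      + m\<^sup>2 - 2 * m * common G u v" for u v
  proof (cases "u = v")
    case True
    then show ?thesis by (simp add: power2_eq_square algebra_simps)
  next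
    case False
    have "(common G u v - e * adj G u v - m)\<^sup>2 = (common G u v)\<^sup>2 - 2 * e * (common G u v * adj G u v)
       + e\<^sup>2 * (adj G u v * adj G u v) + 2 * e * m * adj G u v + m\<^sup>2 - 2 * m * common G u v"
      by (simp add: power2_eq_square algebra_simps)
    then show ?thesis using False
      by (simp add: sq common_sym[of v] adj_sym[of v] power2_eq_square algebra_simps)
  qed
  then have "(\<Sum>u\<in>pverts G. \<Sum>v\<in>pverts G. (common G u v - e * adj G u v - f * of_bool (u = v) - m)\<^sup>2)
    = moment G 4 - 2 * e * moment G 3 + (e\<^sup>2 + 2 * e * m) * (\<Sum>u\<in>pverts G. \<Sum>v\<in>pverts G. adj G u v)
    + (\<Sum>u\<in>pverts G. \<Sum>v\<in>pverts G. of_bool (u = v) * (f\<^sup>2 + 2 * f * m - 2 * f * common G u v))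
    + m\<^sup>2 * (card (pverts G))\<^sup>2 - 2 * m * (\<Sum>u\<in>pverts G. \<Sum>v\<in>pverts G. common G u v)"
    by (simp add: sum.distrib sum_subtractf spectrum_moments power2_eq_square flip: sum_distrib_left)
  also have "(\<Sum>u\<in>pverts G. \<Sum>v\<in>pverts G. adj G u v) = moment G 2"
    by (simp add: sum_adj common_self spectrum_moments)
  also have "(\<Sum>u\<in>pverts G. \<Sum>v\<in>pverts G. of_bool (u = v) * (f\<^sup>2 + 2 * f * m - 2 * f * common G u v))
     = (f\<^sup>2 + 2 * f * m) * card (pverts G) - 2 * f * moment G 2"
    by (simp add: sum_of_bool_eq spectrum_moments sum_subtractf flip: sum_distrib_left)
  finally show ?thesis
    by (simp only: sum_common) (simp add: algebra_simps)
qed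

end

subsection \<open>Cospectral graphs of strongly regular graphs\<close>

locale srg = pair_graph +
  fixes n d lam mu :: nat
  assumes srg: "strongly_regular G n d lam mu"
begin

lemma card_verts: "card (pverts G) = n"
  and card_nbrs: "v \<in> pverts G \<Longrightarrow> card (nbrs G v) = d"
  and card_nbrs_adj: "(u, v) \<in> parcs G \<Longrightarrow> card (nbrs G u \<inter> nbrs G v) = lam"
  and card_nbrs_nonadj: "\<lbrakk>u \<in> pverts G; v \<in> pverts G; u \<noteq> v; (u, v) \<notin> parcs G\<rbrakk>
    \<Longrightarrow> card (nbrs G u \<inter> nbrs G v) = mu"
  using srg unfolding strongly_regular_def by (blast dest: in_arcsD1 in_arcsD2)+

lemma ex_arc: "\<exists>u v. (u, v) \<in> parcs G"
  using srg unfolding strongly_regular_def empty_graph_def by auto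

lemma ex_nonadj: "\<exists>u\<in>pverts G. \<exists>v\<in>pverts G. u \<noteq> v \<and> (u, v) \<notin> parcs G"
  using srg unfolding strongly_regular_def complete_graph_def by auto

text \<open>This is the matrix equation \<open>A^2 = (lam - mu) A + (d - mu) I + mu J\<close>, read
  entry by entry for equal, adjacent and nonadjacent pairs.\<close>

lemma common_eq:
  assumes "u \<in> pverts G" "v \<in> pverts G"
  shows "common G u v = (real lam - real mu) * adj G u v + (real d - real mu) * of_bool (u = v) + real mu"
proof (cases "u = v")
  case True
  then show ?thesis using assms by (simp add: common_def card_nbrs)
next
  case False
  then show ?thesis using assms
    by (cases "(u, v) \<in> parcs G") (simp_all add: common_def adj_def card_nbrs_adj card_nbrs_nonadj)
qed

text \<open>The strict bounds come from an arc \<open>(u, v)\<close>: \<open>v\<close> is a neighbor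
  of \<open>u\<close> but not of itself, and \<open>u\<close> is not its own neighbor. The bound on
  \<open>mu\<close> needs a nonadjacent pair, which exists because \<open>G\<close> is not
  complete.\<close>

lemma params_le: "lam < d" "mu \<le> d" "d < n"
proof -
  obtain u v where uv: "(u, v) \<in> parcs G" using ex_arc by blast
  have "v \<in> nbrs G u" "v \<notin> nbrs G v" using uv no_loops' by (auto simp: nbrs_def)
  then have "nbrs G u \<inter> nbrs G v \<subset> nbrs G u" by blast
  from psubset_card_mono[OF finite_nbrs this] show "lam < d"
    using card_nbrs_adj[OF uv] card_nbrs[of u] uv in_arcsD1 by simp
  have u: "u \<in> pverts G" using uv in_arcsD1 by simp
  then have "nbrs G u \<subset> pverts G" using nbrs_subset by blast
  from psubset_card_mono[OF finite_pverts this] show "d < n"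
    using u by (simp add: card_verts card_nbrs)
  obtain x y where xy: "x \<in> pverts G" "y \<in> pverts G" "x \<noteq> y" "(x, y) \<notin> parcs G"
    using ex_nonadj by blast
  have "card (nbrs G x \<inter> nbrs G y) \<le> card (nbrs G x)" by (intro card_mono) auto
  then show "mu \<le> d" using xy by (simp add: card_nbrs card_nbrs_nonadj)
qed

text \<open>Row sums of the matrix equation \<open>common_eq\<close>; a rearrangement of the
  familiar \<open>d (d - lam - 1) = (n - d - 1) mu\<close>.\<close>

lemma param_identity: "(real d)\<^sup>2 = (real lam - real mu) * d + (real d - real mu) + real mu * n"
proof -
  obtain u where u: "u \<in> pverts G" using ex_nonadj by blast
  have "(\<Sum>v\<in>pverts G. common G u v) = (\<Sum>w\<in>pverts G. \<Sum>v\<in>pverts G. adj G u w * adj G w v)"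
    unfolding sum_adj_adj[symmetric] by (rule sum.swap)
  also have "\<dots> = (\<Sum>w\<in>pverts G. adj G u w * d)"
    by (intro sum.cong) (simp_all add: sum_adj card_nbrs flip: sum_distrib_left)
  also have "\<dots> = (real d)\<^sup>2"
    using u by (simp add: sum_adj card_nbrs power2_eq_square flip: sum_distrib_right)
  finally have "(\<Sum>v\<in>pverts G. common G u v) = (real d)\<^sup>2" .
  moreover have "(\<Sum>v\<in>pverts G. common G u v) = (\<Sum>v\<in>pverts G. (real lam - real mu) * adj G u v
      + of_bool (u = v) * (real d - real mu) + real mu)"
    using u by (intro sum.cong) (simp_all add: common_eq)
  moreover have "\<dots> = (real lam - real mu) * d + (real d - real mu) + real mu * n"
    using u by (simp add: sum.distrib sum_of_bool_eq sum_adj card_nbrs card_verts flip: sum_distrib_left)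
  ultimately show ?thesis by simp
qed

lemma sum_deg_square: "(\<Sum>v\<in>pverts G. (common G v v)\<^sup>2) = real n * (real d)\<^sup>2"
  by (simp add: common_self card_nbrs card_verts)

lemma moment_2: "moment G 2 = real n * real d"
  by (simp add: spectrum_moments common_self card_nbrs card_verts)

end

lemma strongly_regular_cospectral:
  fixes G :: "'a pair_pre_digraph" and H :: "'b pair_pre_digraph"
  assumes srg: "srg G n d lam mu" and H: "pair_graph H"
    and spec: "adj_spectrum H = adj_spectrum G"
  shows "strongly_regular H n d lam mu"
proof -
  interpret G: srg G n d lam mu by fact
  interpret H: pair_graph H by fact
  define e f m where "e = real lam - real mu" and "f = real d - real mu" and "m = real mu"
  define SG where "SG = (\<Sum>v\<in>pverts G. (common G v v)\<^sup>2)"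
  define SH where "SH = (\<Sum>v\<in>pverts H. (common H v v)\<^sup>2)"
  have mom: "moment H k = moment G k" for k by (simp add: moment_def spec)
  have card: "card (pverts H) = n"
    using G.spectrum_moments(1) H.spectrum_moments(1) spec G.card_verts by simp
  have n: "n > 0" "d > 0" using G.params_le by auto
  have sum_deg: "(\<Sum>v\<in>pverts H. common H v v) = real n * real d"
    using H.spectrum_moments(2) mom G.moment_2 by simp
  \<comment> \<open>The second moment makes \<open>d\<close> the mean degree of \<open>H\<close>, so
    this is \<open>n\<close> times the variance of its degrees.\<close>
  have "0 \<le> (\<Sum>v\<in>pverts H. (common H v v - d)\<^sup>2)" by (intro sum_nonneg) auto
  also have "\<dots> = SH - 2 * d * (real n * real d) + real n * (real d)\<^sup>2"
    unfolding sum_deg[symmetric] SH_def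
    by (simp add: power2_diff sum.distrib sum_subtractf card sum_distrib_left mult_ac)
  finally have SH_ge: "SG \<le> SH" unfolding SG_def G.sum_deg_square by (simp add: power2_eq_square mult_ac)
  let ?Q = "\<lambda>X u v. (common X u v - e * adj X u v - f * of_bool (u = v) - m)\<^sup>2"
  \<comment> \<open>With the coefficients of \<open>G\<close> used for both graphs, the two
    expansions agree except in the sum of squared degrees.\<close>
  have "(\<Sum>u\<in>pverts H. \<Sum>v\<in>pverts H. ?Q H u v)
      = (\<Sum>u\<in>pverts G. \<Sum>v\<in>pverts G. ?Q G u v) - 2 * m * (SH - SG)"
    unfolding G.sum_square_defect H.sum_square_defect mom card G.card_verts SH_def SG_def
    by (simp add: algebra_simps)
  also have "(\<Sum>u\<in>pverts G. \<Sum>v\<in>pverts G. ?Q G u v) = 0"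
    by (intro sum.neutral ballI) (simp add: G.common_eq e_def f_def m_def)
  finally have "(\<Sum>u\<in>pverts H. \<Sum>v\<in>pverts H. ?Q H u v) \<le> 0"
    using SH_ge by (simp add: m_def)
  moreover have "0 \<le> (\<Sum>u\<in>pverts H. \<Sum>v\<in>pverts H. ?Q H u v)" by (intro sum_nonneg) auto
  ultimately have "(\<Sum>u\<in>pverts H. \<Sum>v\<in>pverts H. ?Q H u v) = 0" by linarith
  then have "\<forall>u\<in>pverts H. \<forall>v\<in>pverts H. ?Q H u v = 0"
    by (simp add: sum_nonneg_eq_0_iff sum_nonneg)
  then have eq: "common H u v = e * adj H u v + f * of_bool (u = v) + m"
    if "u \<in> pverts H" "v \<in> pverts H" for u v using that by fastforce
  \<comment> \<open>Regularity is the diagonal of the matrix equation, where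
    \<open>f + m = d\<close>.\<close>
  have deg: "card (nbrs H v) = d" if "v \<in> pverts H" for v
    using eq[OF that that] by (simp add: H.common_self f_def m_def)
  have "card (nbrs H u \<inter> nbrs H v) = lam"
    if "u \<in> pverts H" "v \<in> pverts H" "(u, v) \<in> parcs H" for u v
    using eq[OF that(1,2)] that(3) H.no_loops'[of u v]
    by (simp add: common_def adj_def e_def m_def)
  moreover have "card (nbrs H u \<inter> nbrs H v) = mu"
    if "u \<in> pverts H" "v \<in> pverts H" "u \<noteq> v" "(u, v) \<notin> parcs H" for u v
    using eq[OF that(1,2)] that(3,4) by (simp add: common_def adj_def m_def)
  moreover have "parcs H \<noteq> {}"
  proof
    assume "parcs H = {}"
    then have "nbrs H v = {}" for v by (simp add: nbrs_def)
    moreover obtain v where "v \<in> pverts H" using card n by fastforce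
    ultimately show False using deg n by fastforce
  qed
  moreover have "\<not> complete_graph H"
  proof
    assume complete: "complete_graph H"
    obtain v where v: "v \<in> pverts H" using card n by fastforce
    then have "nbrs H v = pverts H - {v}"
      using complete H.nbrs_subset[of v] by (auto simp: complete_graph_def nbrs_def)
    then have "d = n - 1" using deg[OF v] card v by simp
    \<comment> \<open>Completeness of \<open>H\<close> forces \<open>d = n - 1\<close>, but a
      nonadjacent pair in \<open>G\<close> gives \<open>d \<le> n - 2\<close>. Under truncated
      subtraction these are compatible only for \<open>n \<le> 1\<close>, which \<open>d > 0\<close>
      excludes.\<close>
    obtain x y where xy: "x \<in> pverts G" "y \<in> pverts G" "x \<noteq> y" "(x, y) \<notin> parcs G"
      using G.ex_nonadj by blast
    have "nbrs G x \<subseteq> pverts G - {x, y}" using G.nbrs_subset[of x] xy by (auto simp: nbrs_def)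
    then have "card (nbrs G x) \<le> card (pverts G - {x, y})" by (intro card_mono) auto
    also have "\<dots> = n - 2" using xy by (simp add: card_Diff_subset G.card_verts)
    finally have "d \<le> n - 2" using xy by (simp add: G.card_nbrs)
    then show False using \<open>d = n - 1\<close> n by auto
  qed
  ultimately show ?thesis
    using card deg unfolding strongly_regular_def empty_graph_def by blast
qed

section \<open>Counting edges and triangles\<close>

context srg
begin

text \<open>Double counting of arcs: every edge is the image of exactly two arcs.\<close>

lemma num_edges_eq: "2 * num_edges G = n * d"
proof -
  let ?h = "\<lambda>(u, v). {u, v}"
  have arcs: "parcs G = (SIGMA u:pverts G. nbrs G u)"
    using in_arcsD1 by (auto simp: nbrs_def)
  have "n * d = card (parcs G)"
    unfolding arcs by (simp add: card_nbrs card_verts)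
  also have "\<dots> = (\<Sum>e\<in>?h ` parcs G. card {p \<in> parcs G. ?h p = e})"
    using sum.image_gen[OF pair_finite_arcs, of "\<lambda>_. 1 :: nat" ?h] by simp
  also have "\<dots> = (\<Sum>e\<in>?h ` parcs G. 2)"
  proof (intro sum.cong refl)
    fix e assume "e \<in> ?h ` parcs G"
    then obtain u v where e: "e = {u, v}" and uv: "(u, v) \<in> parcs G" by auto
    have vu: "(v, u) \<in> parcs G" using uv arc_sym by blast
    have "{p \<in> parcs G. ?h p = e} = {(u, v), (v, u)}"
    proof (rule Set.set_eqI)
      fix p :: "'a \<times> 'a"
      obtain a b where p: "p = (a, b)" by fastforce
      have "p \<in> {p \<in> parcs G. ?h p = e} \<longleftrightarrow> (a, b) \<in> parcs G \<and> (a = u \<and> b = v \<or> a = v \<and> b = u)"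
        unfolding p e mem_Collect_eq prod.case doubleton_eq_iff ..
      then show "p \<in> {p \<in> parcs G. ?h p = e} \<longleftrightarrow> p \<in> {(u, v), (v, u)}"
        using uv vu unfolding p by blast
    qed
    then show "card {p \<in> parcs G. ?h p = e} = 2" using no_loops'[OF uv] by simp
  qed
  also have "?h ` parcs G = {{u, v} | u v. (u, v) \<in> parcs G}" by auto
  finally show ?thesis by (simp add: num_edges_def)
qed

text \<open>Double counting of ordered triangles: each of the \<open>n * d\<close> arcs extends to
  one in \<open>lam\<close> ways, and each triangle has six orderings.\<close>

lemma num_triangles_eq: "6 * num_triangles G = n * d * lam"
proof -
  let ?h = "\<lambda>((u, v), w). {u, v, w}"
  define T where "T = (SIGMA p:parcs G. nbrs G (fst p) \<inter> nbrs G (snd p))"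
  have T: "((u, v), w) \<in> T \<longleftrightarrow> (u, v) \<in> parcs G \<and> (v, w) \<in> parcs G \<and> (u, w) \<in> parcs G" for u v w
    by (auto simp: T_def nbrs_def)
  have "finite T" by (auto simp: T_def pair_finite_arcs)
  have arcs: "parcs G = (SIGMA u:pverts G. nbrs G u)"
    using in_arcsD1 by (auto simp: nbrs_def)
  have "card (parcs G) = n * d"
    unfolding arcs by (simp add: card_nbrs card_verts)
  moreover have "card T = (\<Sum>p\<in>parcs G. lam)"
    unfolding T_def by (subst card_SigmaI) (auto simp: pair_finite_arcs card_nbrs_adj intro!: sum.cong)
  ultimately have "n * d * lam = card T" by simp
  also have "\<dots> = (\<Sum>e\<in>?h ` T. card {p \<in> T. ?h p = e})"
    using sum.image_gen[OF \<open>finite T\<close>, of "\<lambda>_. 1 :: nat" ?h] by simp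
  also have "\<dots> = (\<Sum>e\<in>?h ` T. 6)"
  proof (intro sum.cong refl)
    fix e assume "e \<in> ?h ` T"
    then obtain u v w where e: "e = {u, v, w}" and t: "((u, v), w) \<in> T" by auto
    have ne: "u \<noteq> v" "v \<noteq> w" "u \<noteq> w" using t no_loops' by (auto simp: T)
    \<comment> \<open>The coordinates of an ordered triangle are distinct, since there are no loops;
      so a triple over \<open>{u, v, w}\<close> must be one of its permutations.\<close>
    have sub: "p \<in> {((u, v), w), ((u, w), v), ((v, u), w), ((v, w), u), ((w, u), v), ((w, v), u)}"
      if "p \<in> T" "?h p = e" for p
    proof -
      obtain a b c where p: "p = ((a, b), c)" by (metis prod.exhaust)
      have abc: "a \<noteq> b" "b \<noteq> c" "a \<noteq> c" using that no_loops' by (auto simp: T p)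
      have "a \<in> {u, v, w}" "b \<in> {u, v, w}" "c \<in> {u, v, w}" using that by (auto simp: p e)
      then show ?thesis using abc unfolding p by auto
    qed
    have "{p \<in> T. ?h p = e} = {((u, v), w), ((u, w), v), ((v, u), w), ((v, w), u), ((w, u), v), ((w, v), u)}"
    proof (intro equalityI subsetI)
      fix p assume "p \<in> {((u, v), w), ((u, w), v), ((v, u), w), ((v, w), u), ((w, u), v), ((w, v), u)}"
      moreover have "(v, u) \<in> parcs G" "(w, v) \<in> parcs G" "(w, u) \<in> parcs G"
        using t arc_sym unfolding T by blast+
      with t have "{((u, v), w), ((u, w), v), ((v, u), w), ((v, w), u), ((w, u), v), ((w, v), u)} \<subseteq> T"
        by (simp add: T)
      ultimately show "p \<in> {p \<in> T. ?h p = e}" by (auto simp: e)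
    qed (use sub in blast)
    then show "card {p \<in> T. ?h p = e} = 6" using ne by simp
  qed
  also have "?h ` T = {{u, v, w} | u v w. (u, v) \<in> parcs G \<and> (v, w) \<in> parcs G \<and> (u, w) \<in> parcs G}"
    by (force simp: T image_iff)
  finally show ?thesis by (simp add: num_triangles_def)
qed

end

context srg
begin

subsection \<open>Diameter and girth\<close>

lemma card_Int_nbrs_pos: "w \<in> nbrs G u \<inter> nbrs G v \<Longrightarrow> card (nbrs G u \<inter> nbrs G v) > 0"
  by (auto simp: card_gt_0_iff)

lemma nonadj_common_nbr:
  assumes "mu > 0" "u \<in> pverts G" "v \<in> pverts G" "u \<noteq> v" "(u, v) \<notin> parcs G"
  obtains w where "(u, w) \<in> parcs G" "(w, v) \<in> parcs G"
proof -
  have "nbrs G u \<inter> nbrs G v \<noteq> {}" using card_nbrs_nonadj[OF assms(2-)] assms(1) by force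
  then show thesis using that arc_sym by (auto simp: nbrs_def)
qed

text \<open>If \<open>mu = 0\<close>, a path of length two never joins distinct nonadjacent
  vertices. By induction, everything reachable from \<open>u\<close> is then equal or adjacent to
  \<open>u\<close>, against the existence of a nonadjacent pair.\<close>

lemma connected_imp_mu_pos:
  assumes conn: "Digraph_Component.connected (with_proj G)"
  shows "mu > 0"
proof (rule ccontr)
  assume "\<not> mu > 0"
  then have mu: "mu = 0" by simp
  obtain u v where uv: "u \<in> pverts G" "v \<in> pverts G" "u \<noteq> v" "(u, v) \<notin> parcs G"
    using ex_nonadj by blast
  have "u \<rightarrow>\<^sup>*\<^bsub>mk_symmetric (with_proj G)\<^esub> v"
    using conn uv unfolding Digraph_Component.connected_def strongly_connected_def by simp
  then have "u \<rightarrow>\<^sup>*\<^bsub>with_proj G\<^esub> v"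
    using reachable_mk_symmetric_eq sym_arcs by blast
  then have "u = v \<or> (u, v) \<in> parcs G"
  proof (induction rule: reachable_induct)
    case (step x y)
    then have xy: "(x, y) \<in> parcs G" by simp
    show ?case
    proof (rule ccontr)
      assume *: "\<not> (u = y \<or> (u, y) \<in> parcs G)"
      then have "(u, x) \<in> parcs G" using step xy by auto
      then have "x \<in> nbrs G u \<inter> nbrs G y" using xy arc_sym by (auto simp: nbrs_def)
      moreover have "card (nbrs G u \<inter> nbrs G y) = 0"
        using * uv(1) in_arcsD2[OF xy] mu by (simp add: card_nbrs_nonadj)
      ultimately show False using card_Int_nbrs_pos by fastforce
    qed
  qed simp
  then show False using uv by simp
qed

lemma graph_dist_eq:
  "graph_dist G u v = (INF p\<in>{p. pre_digraph.awalk (with_proj G) u p v}. ereal (real (length p)))"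
proof -
  have wf: "wf_digraph (with_proj G)" by unfold_locales
  have "awalk_cost (\<lambda>_. 1) p = real (length p)" for p :: "('a \<times> 'a) list"
    by (simp add: awalk_cost_def sum_list_triv)
  then show ?thesis by (simp add: graph_dist_def wf_digraph.\<mu>_def[OF wf])
qed

lemma awalk_with_proj_iff:
  "pre_digraph.awalk (with_proj G) u p v \<longleftrightarrow>
     u \<in> pverts G \<and> set p \<subseteq> parcs G \<and> pre_digraph.cas (with_proj G) u p v"
  by (simp add: pre_digraph.awalk_def)

text \<open>Nonadjacent vertices have a common neighbor since \<open>mu > 0\<close>, which bounds
  all distances by 2; a nonadjacent pair attains the bound.\<close>

lemma diam_eq:
  assumes mu: "mu > 0"
  shows "diam G = 2"
proof (rule antisym)
  show "diam G \<le> 2"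
    unfolding diam_def
  proof (intro SUP_least)
    fix u v assume uv: "u \<in> pverts G" "v \<in> pverts G"
    have "\<exists>p. pre_digraph.awalk (with_proj G) u p v \<and> length p \<le> 2"
    proof -
      consider "u = v" | "(u, v) \<in> parcs G" | "u \<noteq> v" "(u, v) \<notin> parcs G" by blast
      then show ?thesis
      proof cases
        case 1
        then show ?thesis using uv by (intro exI[of _ "[]"]) (simp add: awalk_with_proj_iff)
      next
        case 2
        then show ?thesis using uv by (intro exI[of _ "[(u, v)]"]) (simp add: awalk_with_proj_iff)
      next
        case 3
        obtain w where "(u, w) \<in> parcs G" "(w, v) \<in> parcs G"
          using nonadj_common_nbr[OF mu uv 3] by blast
        then show ?thesis using uv
          by (intro exI[of _ "[(u, w), (w, v)]"]) (simp add: awalk_with_proj_iff)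
      qed
    qed
    then show "graph_dist G u v \<le> 2"
      unfolding graph_dist_eq by (auto intro!: INF_lower2)
  qed
next
  obtain u v where uv: "u \<in> pverts G" "v \<in> pverts G" "u \<noteq> v" "(u, v) \<notin> parcs G"
    using ex_nonadj by blast
  have "2 \<le> graph_dist G u v"
    unfolding graph_dist_eq
  proof (intro INF_greatest)
    fix p assume "p \<in> {p. pre_digraph.awalk (with_proj G) u p v}"
    then have w: "set p \<subseteq> parcs G" "pre_digraph.cas (with_proj G) u p v"
      by (auto simp: awalk_with_proj_iff)
    have "length p \<noteq> 0" "length p \<noteq> 1"
      using w uv(3,4) by (auto simp: length_Suc_conv)
    then have "2 \<le> length p" by linarith
    then show "2 \<le> ereal (real (length p))" by simp
  qed
  then show "2 \<le> diam G"
    unfolding diam_def using uv by (intro SUP_upper2[of u] SUP_upper2[of v]) auto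
qed

section \<open>Short cycles\<close>

lemma cycle_with_proj_iff:
  "pre_digraph.cycle (with_proj G) p \<longleftrightarrow>
     (\<exists>u\<in>pverts G. set p \<subseteq> parcs G \<and> pre_digraph.cas (with_proj G) u p u \<and>
       distinct (tl (pre_digraph.awalk_verts (with_proj G) u p)) \<and> p \<noteq> [])"
  by (auto simp: pre_digraph.cycle_def pre_digraph.awalk_def)

lemma lam_pos_iff: "lam > 0 \<longleftrightarrow> (\<exists>u v w. (u, v) \<in> parcs G \<and> (v, w) \<in> parcs G \<and> (w, u) \<in> parcs G)"
proof
  assume "lam > 0"
  obtain u v where uv: "(u, v) \<in> parcs G" using ex_arc by blast
  then have "nbrs G u \<inter> nbrs G v \<noteq> {}" using card_nbrs_adj[OF uv] \<open>lam > 0\<close> by force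
  then show "\<exists>u v w. (u, v) \<in> parcs G \<and> (v, w) \<in> parcs G \<and> (w, u) \<in> parcs G"
    using uv arc_sym by (auto simp: nbrs_def)
next
  assume "\<exists>u v w. (u, v) \<in> parcs G \<and> (v, w) \<in> parcs G \<and> (w, u) \<in> parcs G"
  then obtain u v w where uvw: "(u, v) \<in> parcs G" "(v, w) \<in> parcs G" "(w, u) \<in> parcs G" by blast
  then have "w \<in> nbrs G u \<inter> nbrs G v" using arc_sym by (auto simp: nbrs_def)
  then show "lam > 0" using card_Int_nbrs_pos card_nbrs_adj[OF uvw(1)] by metis
qed

text \<open>Two common neighbors of a nonadjacent pair close a quadrilateral.\<close>

lemma ex_cycle_4:
  assumes mu: "mu \<ge> 2"
  shows "\<exists>p. pre_digraph.cycle (with_proj G) p \<and> length p = 4"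
proof -
  obtain u w where uw: "u \<in> pverts G" "w \<in> pverts G" "u \<noteq> w" "(u, w) \<notin> parcs G"
    using ex_nonadj by blast
  have "2 \<le> card (nbrs G u \<inter> nbrs G w)" using card_nbrs_nonadj[OF uw] mu by simp
  then obtain S where "S \<subseteq> nbrs G u \<inter> nbrs G w" "card S = 2"
    using obtain_subset_with_card_n by metis
  then obtain v x where vx: "v \<noteq> x" "v \<in> nbrs G u \<inter> nbrs G w" "x \<in> nbrs G u \<inter> nbrs G w"
    unfolding card_2_iff by blast
  then have arcs: "(u, v) \<in> parcs G" "(v, w) \<in> parcs G" "(w, x) \<in> parcs G" "(x, u) \<in> parcs G"
    using arc_sym by (auto simp: nbrs_def)
  then have "pre_digraph.cycle (with_proj G) [(u, v), (v, w), (w, x), (x, u)]"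
    using uw vx no_loops' by (auto simp: cycle_with_proj_iff)
  then show ?thesis by (intro exI[of _ "[(u, v), (v, w), (w, x), (x, u)]"]) simp
qed

text \<open>When \<open>mu = 1\<close>, take a path \<open>u, v, w\<close> with nonadjacent ends and
  a second neighbor \<open>x\<close> of \<open>u\<close>. Uniqueness of the common neighbor keeps
  \<open>x\<close> and \<open>w\<close> nonadjacent, so they have a common neighbor
  \<open>y\<close>, which closes a pentagon.\<close>

lemma ex_cycle_5:
  assumes lam: "lam = 0" and mu: "mu > 0"
  shows "mu \<ge> 2 \<or> (\<exists>p. pre_digraph.cycle (with_proj G) p \<and> length p = 5)"
proof (cases "mu \<ge> 2")
  case False
  with mu have mu1: "mu = 1" by simp
  have triangle_free: "(a, b) \<in> parcs G \<Longrightarrow> (b, c) \<in> parcs G \<Longrightarrow> (c, a) \<notin> parcs G" for a b c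
    using lam_pos_iff lam by blast
  obtain u w where uw: "u \<in> pverts G" "w \<in> pverts G" "u \<noteq> w" "(u, w) \<notin> parcs G"
    using ex_nonadj by blast
  obtain v where v: "(u, v) \<in> parcs G" "(v, w) \<in> parcs G"
    using nonadj_common_nbr[OF mu uw] by blast
  \<comment> \<open>\<open>v\<close> visibly has two neighbors, and regularity carries the bound
    over to \<open>u\<close>.\<close>
  have "card {u, w} \<le> card (nbrs G v)"
    using v arc_sym by (intro card_mono finite_nbrs) (auto simp: nbrs_def)
  then have "card (nbrs G u) \<ge> 2" using uw v in_arcsD2 by (simp add: card_nbrs)
  then have "\<not> nbrs G u \<subseteq> {v}" using card_mono[of "{v}" "nbrs G u"] by auto
  then obtain x where x: "(u, x) \<in> parcs G" "x \<noteq> v" by (auto simp: nbrs_def)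
  have "(x, w) \<notin> parcs G"
  proof
    assume "(x, w) \<in> parcs G"
    then have "{v, x} \<subseteq> nbrs G u \<inter> nbrs G w" using x v arc_sym by (auto simp: nbrs_def)
    then have "card {v, x} \<le> card (nbrs G u \<inter> nbrs G w)" by (intro card_mono) auto
    then show False using x card_nbrs_nonadj[OF uw] mu1 by simp
  qed
  moreover have "x \<noteq> w" using x uw by auto
  ultimately obtain y where y: "(x, y) \<in> parcs G" "(y, w) \<in> parcs G"
    using nonadj_common_nbr[OF mu, of x w] in_arcsD2[OF x(1)] uw by blast
  have "y \<noteq> u" using y uw by auto
  have "y \<noteq> v" using triangle_free[of u x y] x(1) y(1) v(1) arc_sym by blast
  have "pre_digraph.cycle (with_proj G) [(u, v), (v, w), (w, y), (y, x), (x, u)]"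
    using uw v x y \<open>x \<noteq> w\<close> \<open>y \<noteq> u\<close> \<open>y \<noteq> v\<close> no_loops' arc_sym[of y w] arc_sym[of x y] arc_sym[of x u]
    by (auto simp: cycle_with_proj_iff)
  then have "\<exists>p. pre_digraph.cycle (with_proj G) p \<and> length p = 5"
    by (intro exI[of _ "[(u, v), (v, w), (w, y), (y, x), (x, u)]"]) simp
  then show ?thesis ..
qed simp

lemma cycle_3_imp_lam_pos:
  assumes "pre_digraph.cycle (with_proj G) p" "length p = 3"
  shows "lam > 0"
proof -
  obtain a b c where p: "p = [a, b, c]" using assms(2) by (auto simp: length_Suc_conv numeral_3_eq_3)
  show ?thesis using assms(1) unfolding p lam_pos_iff
    by (cases a; cases b; cases c) (auto simp: cycle_with_proj_iff)
qed

text \<open>Two opposite corners of a quadrilateral are either adjacent, giving a triangle, or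
  nonadjacent with the other two corners as common neighbors.\<close>

lemma cycle_4_imp:
  assumes "pre_digraph.cycle (with_proj G) p" "length p = 4"
  shows "lam > 0 \<or> mu \<ge> 2"
proof -
  obtain p1 p2 p3 p4 where p: "p = [p1, p2, p3, p4]"
    using assms(2) by (auto simp: length_Suc_conv eval_nat_numeral)
  obtain a b c e where arcs: "(a, b) \<in> parcs G" "(b, c) \<in> parcs G" "(c, e) \<in> parcs G" "(e, a) \<in> parcs G"
    and ne: "b \<noteq> e" "a \<noteq> c"
    using assms(1) unfolding p
    by (cases p1; cases p2; cases p3; cases p4) (auto simp: cycle_with_proj_iff)
  show ?thesis
  proof (cases "(c, a) \<in> parcs G")
    case True
    then show ?thesis using arcs lam_pos_iff by blast
  next
    case False
    then have "(a, c) \<notin> parcs G" using arc_sym by blast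
    then have "card (nbrs G a \<inter> nbrs G c) = mu"
      using ne arcs in_arcsD1 by (intro card_nbrs_nonadj) auto
    moreover have "card {b, e} \<le> card (nbrs G a \<inter> nbrs G c)"
      using arcs arc_sym by (intro card_mono finite_Int finite_nbrs disjI1) (auto simp: nbrs_def)
    ultimately show ?thesis using ne by simp
  qed
qed

lemma girth_eqI:
  assumes "\<exists>p. pre_digraph.cycle (with_proj G) p \<and> length p = k" "3 \<le> k"
    and "\<And>p. \<lbrakk>pre_digraph.cycle (with_proj G) p; 3 \<le> length p\<rbrakk> \<Longrightarrow> k \<le> length p"
  shows "girth G = enat k"
  unfolding girth_def
proof (rule antisym)
  obtain p where "pre_digraph.cycle (with_proj G) p" "length p = k" using assms(1) by blast
  then show "(INF p \<in> {p. pre_digraph.cycle (with_proj G) p \<and> 3 \<le> length p}. enat (length p)) \<le> enat k"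
    using assms(2) by (intro INF_lower2[of p]) auto
qed (use assms(3) in \<open>auto intro!: INF_greatest\<close>)

lemma girth_eq:
  assumes mu: "mu > 0"
  shows "girth G = enat (if lam > 0 then 3 else if mu \<ge> 2 then 4 else 5)"
proof -
  consider "lam > 0" | "lam = 0" "mu \<ge> 2" | "lam = 0" "\<not> mu \<ge> 2" by auto
  then show ?thesis
  proof cases
    case 1
    then obtain u v w where uvw: "(u, v) \<in> parcs G" "(v, w) \<in> parcs G" "(w, u) \<in> parcs G"
      unfolding lam_pos_iff by blast
    then have "pre_digraph.cycle (with_proj G) [(u, v), (v, w), (w, u)]"
      using no_loops' in_arcsD1 by (auto simp: cycle_with_proj_iff)
    then have "\<exists>p. pre_digraph.cycle (with_proj G) p \<and> length p = 3"
      by (intro exI[of _ "[(u, v), (v, w), (w, u)]"]) simp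
    then have "girth G = enat 3" by (intro girth_eqI) auto
    then show ?thesis using 1 by simp
  next
    case 2
    have "girth G = enat 4"
    proof (intro girth_eqI ex_cycle_4)
      fix p assume "pre_digraph.cycle (with_proj G) p" "3 \<le> length p"
      then show "4 \<le> length p" using cycle_3_imp_lam_pos[of p] 2 by fastforce
    qed (use 2 in auto)
    then show ?thesis using 2 by simp
  next
    case 3
    have "girth G = enat 5"
    proof (intro girth_eqI)
      fix p assume "pre_digraph.cycle (with_proj G) p" "3 \<le> length p"
      then show "5 \<le> length p" using cycle_3_imp_lam_pos[of p] cycle_4_imp[of p] 3 by fastforce
    qed (use 3 ex_cycle_5 mu in auto)
    then show ?thesis using 3 by simp
  qed
qed

end

context srg
begin

subsection \<open>The Lovasz theta function\<close>

text \<open>The square root of the discriminant of the quadratic below, that is,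
  \<open>ev_max - ev_min\<close>.\<close>

definition disc :: real where
  "disc = sqrt ((real lam - real mu)\<^sup>2 + 4 * (real d - real mu))"

text \<open>The eigenvalues of \<open>G\<close> other than \<open>d\<close>, the roots of \<open>x\<^sup>2 - (lam - mu) x - (d - mu)\<close>.\<close>

definition ev_max :: real where
  "ev_max = (real lam - real mu + disc) / 2"

definition ev_min :: real where
  "ev_min = (real lam - real mu - disc) / 2"

lemma disc_square: "disc\<^sup>2 = (real lam - real mu)\<^sup>2 + 4 * (real d - real mu)"
  using params_le by (simp add: disc_def)

lemma ev_sum: "ev_max + ev_min = real lam - real mu"
  by (simp add: ev_max_def ev_min_def field_simps)

lemma ev_prod: "ev_max * ev_min = real mu - real d"
proof -
  have "ev_max * ev_min = ((real lam - real mu)\<^sup>2 - disc\<^sup>2) / 4"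
    by (simp add: ev_max_def ev_min_def power2_eq_square field_simps)
  then show ?thesis by (simp add: disc_square)
qed

lemma ev_max_nonneg: "ev_max \<ge> 0"
proof -
  have "\<bar>real lam - real mu\<bar> \<le> disc"
    unfolding disc_def using params_le by (intro real_le_rsqrt) simp
  then show ?thesis by (simp add: ev_max_def)
qed

text \<open>A nonnegative smaller root would force \<open>d = mu\<close> and
  \<open>lam \<ge> mu\<close>, contradicting \<open>lam < d\<close>.\<close>

lemma ev_min_neg: "ev_min < 0"
proof (rule ccontr)
  assume "\<not> ev_min < 0"
  moreover have "disc \<ge> 0" using params_le by (simp add: disc_def)
  ultimately have "real lam \<ge> real mu" "disc \<le> real lam - real mu" by (simp_all add: ev_min_def)
  then have "disc\<^sup>2 \<le> (real lam - real mu)\<^sup>2" using \<open>disc \<ge> 0\<close> by (intro power_mono) auto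
  then have "d = mu" using params_le by (simp add: disc_square)
  then show False using params_le \<open>real lam \<ge> real mu\<close> by simp
qed

text \<open>The quadratic with roots \<open>ev_max\<close> and \<open>ev_min\<close>, evaluated at
  \<open>d\<close> by \<open>param_identity\<close>.\<close>

lemma ev_param_identity: "(real d - ev_max) * (real d - ev_min) = real mu * real n"
proof -
  have "(real d - ev_max) * (real d - ev_min) = (real d)\<^sup>2 - (ev_max + ev_min) * d + ev_max * ev_min"
    by (simp add: power2_eq_square algebra_simps)
  then show ?thesis unfolding ev_sum ev_prod param_identity by simp
qed

lemma d_minus_ev_min_pos: "real d - ev_min > 0"
  using ev_min_neg by simp

text \<open>Squaring \<open>a I + b A + c J\<close> in the Bose-Mesner algebra, with
  \<open>A J = d J\<close> and \<open>J^2 = n J\<close>.\<close>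

lemma sum_bose_mesner_square:
  assumes u: "u \<in> pverts G" and v: "v \<in> pverts G"
  shows "(\<Sum>k\<in>pverts G. (a * of_bool (k = u) + b * adj G k u + c) * (a * of_bool (k = v) + b * adj G k v + c))
    = a\<^sup>2 * of_bool (u = v) + 2 * a * b * adj G u v + 2 * a * c
      + b\<^sup>2 * common G u v + 2 * b * c * d + c\<^sup>2 * n"
proof -
  have "(a * of_bool (k = u) + b * adj G k u + c) * (a * of_bool (k = v) + b * adj G k v + c)
    = of_bool (k = u) * (a * (a * of_bool (k = v) + b * adj G k v + c))
      + of_bool (k = v) * (a * (b * adj G k u + c))
      + b\<^sup>2 * (adj G u k * adj G k v) + b * c * adj G u k + b * c * adj G v k + c\<^sup>2" for k
    by (simp add: adj_sym[of u] adj_sym[of v] power2_eq_square algebra_simps)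
  then have "(\<Sum>k\<in>pverts G. (a * of_bool (k = u) + b * adj G k u + c) * (a * of_bool (k = v) + b * adj G k v + c))
    = a * (a * of_bool (u = v) + b * adj G u v + c) + a * (b * adj G v u + c)
      + b\<^sup>2 * common G u v + b * c * d + b * c * d + c\<^sup>2 * n"
    using u v by (simp add: sum.distrib sum_of_bool_eq sum_adj sum_adj_adj card_nbrs card_verts
        flip: sum_distrib_left)
  then show ?thesis by (simp add: adj_sym[of v u] power2_eq_square algebra_simps)
qed

text \<open>If \<open>x\<close> and \<open>y\<close> are the two eigenvalues other than \<open>d\<close>, this is \<open>x - y\<close> times the projection
  onto the eigenspace of \<open>y\<close>.\<close>

definition eig_mat :: "real \<Rightarrow> 'a \<Rightarrow> 'a \<Rightarrow> real" where
  "eig_mat x u v = x * of_bool (u = v) - adj G u v + (real d - x) / n"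

text \<open>The matrix \<open>x I - A + c J\<close> vanishes on the eigenspace of \<open>x\<close>
  and, by the choice of \<open>c\<close>, on constant vectors; on the eigenspace of \<open>y\<close>
  it acts as \<open>x - y\<close>. It is symmetric, so the sum over \<open>k\<close> is an entry of
  its square. The hypotheses are symmetric in \<open>x\<close> and \<open>y\<close>, allowing both
  orders of the eigenvalues.\<close>

lemma eig_mat_square:
  assumes u: "u \<in> pverts G" and v: "v \<in> pverts G"
    and sum: "x + y = real lam - real mu" and prod: "x * y = real mu - real d"
    and id: "(real d - x) * (real d - y) = real mu * n"
  shows "(\<Sum>k\<in>pverts G. eig_mat x k u * eig_mat x k v) = (x - y) * eig_mat x u v"
proof -
  define c where "c = (real d - x) / n"
  have n: "real n > 0" using params_le by simp
  have cn: "c * n = d - x" using n by (simp add: c_def)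
  \<comment> \<open>Expresses the \<open>mu J\<close> part of \<open>A^2\<close> through
    \<open>c\<close>, so that the constant terms collect into \<open>(x - y) * c\<close>.\<close>
  have cmu: "c * (real d - y) = mu" using n id by (simp add: c_def field_simps)
  have "(\<Sum>k\<in>pverts G. eig_mat x k u * eig_mat x k v)
      = x\<^sup>2 * of_bool (u = v) - 2 * x * adj G u v + 2 * x * c + common G u v - 2 * c * d + c\<^sup>2 * n"
    using sum_bose_mesner_square[OF u v, of x "-1" c]
    unfolding eig_mat_def c_def[symmetric] by (simp add: mult.assoc)
  also have "common G u v = (x + y) * adj G u v - x * y * of_bool (u = v) + c * (real d - y)"
    unfolding common_eq[OF u v] sum prod cmu by simp
  also have "c\<^sup>2 * n = c * (real d - x)" using cn by (simp add: power2_eq_square)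
  finally have "(\<Sum>k\<in>pverts G. eig_mat x k u * eig_mat x k v)
     = (x - y) * (x * of_bool (u = v) - adj G u v + c)"
    by (simp add: power2_eq_square algebra_simps)
  then show ?thesis by (simp add: eig_mat_def c_def)
qed

lemma eig_mat_max_square:
  assumes "u \<in> pverts G" "v \<in> pverts G"
  shows "(\<Sum>k\<in>pverts G. eig_mat ev_max k u * eig_mat ev_max k v) = (ev_max - ev_min) * eig_mat ev_max u v"
  using eig_mat_square[OF assms ev_sum ev_prod ev_param_identity] .

lemma eig_mat_min_square:
  assumes "u \<in> pverts G" "v \<in> pverts G"
  shows "(\<Sum>k\<in>pverts G. eig_mat ev_min k u * eig_mat ev_min k v) = (ev_min - ev_max) * eig_mat ev_min u v"
  using eig_mat_square[OF assms, of ev_min ev_max] ev_sum ev_prod ev_param_identity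
  by (simp add: add.commute mult.commute)

text \<open>The Hoffman ratio bound of a regular graph with least eigenvalue
  \<open>ev_min\<close>.\<close>

definition theta_value :: real where
  "theta_value = - ev_min * n / (real d - ev_min)"

text \<open>The form that the dual certificate \<open>ev_max I - A + J\<close> delivers: its row sum
  divided by its diagonal entry.\<close>

lemma theta_value_alt: "theta_value = (real n - real d + ev_max) / (1 + ev_max)"
proof -
  have "- ev_min * n * (1 + ev_max) = - ev_min * n - (ev_max * ev_min) * n"
    by (simp add: algebra_simps)
  also have "\<dots> = - ev_min * n + d * real n - real mu * real n" by (simp add: ev_prod algebra_simps)
  also have "\<dots> = (real n - real d + ev_max) * (real d - ev_min)"
    unfolding ev_param_identity[symmetric] by (simp add: algebra_simps)
  finally show ?thesis
    unfolding theta_value_def using d_minus_ev_min_pos ev_max_nonneg by (subst frac_eq_eq) auto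
qed

lemma theta_value_pos: "theta_value > 0"
  unfolding theta_value_def using d_minus_ev_min_pos ev_min_neg params_le
  by (intro divide_pos_pos mult_pos_pos) auto

lemma verts_nonempty: "pverts G \<noteq> {}"
  using ex_nonadj by blast

text \<open>The vectors are the rows of \<open>eig_mat ev_min\<close>, rescaled and extended by a constant
  coordinate in the direction of \<open>c\<close>; their Gram matrix is \<open>I - A / ev_min\<close>.\<close>

lemma lovasz_theta_le: "lovasz_theta G \<le> ereal theta_value"
proof -
  obtain vs where vs: "distinct vs" "set vs = pverts G"
    using finite_distinct_list[OF finite_pverts] by blast
  define N where "N = length vs"
  \<comment> \<open>The common inner product with \<open>c\<close>, so that every vertex contributes
    exactly \<open>theta_value\<close> to the maximum.\<close>
  define p where "p = 1 / sqrt theta_value"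
  \<comment> \<open>Scales the Gram matrix of the \<open>eig_mat ev_min\<close> part to
    \<open>eig_mat ev_min / ev_min\<close>.\<close>
  define q where "q = 1 / sqrt ((ev_max - ev_min) * (- ev_min))"
  define U :: "'a \<Rightarrow> real vec" where
    "U u = vec (Suc N) (\<lambda>k. if k = 0 then p else q * eig_mat ev_min (vs ! (k - 1)) u)" for u
  have U_carrier: "U u \<in> carrier_vec (Suc N)" for u by (simp add: U_def)
  define c :: "real vec" where "c = vec (Suc N) (\<lambda>k. of_bool (k = 0))"
  have pos: "(ev_max - ev_min) * (- ev_min) > 0"
    using ev_min_neg ev_max_nonneg by (intro mult_pos_pos) auto
  have p2: "p * p = 1 / theta_value" and q2: "q * q = 1 / ((ev_max - ev_min) * (- ev_min))"
    using theta_value_pos pos by (simp_all add: p_def q_def)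
  have n: "real n > 0" using params_le by simp
  have "scalar_prod (U u) (U v) = of_bool (u = v) - adj G u v / ev_min"
    if "u \<in> pverts G" "v \<in> pverts G" for u v
  proof -
    have "scalar_prod (U u) (U v) = (\<Sum>k<Suc N. U u $ k * U v $ k)"
      by (simp add: scalar_prod_def U_def atLeast0LessThan)
    also have "\<dots> = p * p + (\<Sum>k<N. q * eig_mat ev_min (vs ! k) u * (q * eig_mat ev_min (vs ! k) v))"
      by (simp add: sum.lessThan_Suc_shift U_def del: sum.lessThan_Suc)
    also have "\<dots> = p * p + (\<Sum>w\<in>pverts G. q * eig_mat ev_min w u * (q * eig_mat ev_min w v))"
      unfolding N_def
      using sum_nth_distinct[OF vs(1), of "\<lambda>w. q * eig_mat ev_min w u * (q * eig_mat ev_min w v)"]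
      by (simp add: vs(2))
    also have "\<dots> = p * p + (q * q) * (\<Sum>w\<in>pverts G. eig_mat ev_min w u * eig_mat ev_min w v)"
      by (simp add: sum_distrib_left mult_ac)
    also have "\<dots> = 1 / theta_value + eig_mat ev_min u v / ev_min"
      unfolding p2 q2 eig_mat_min_square[OF that] using pos ev_min_neg by (simp add: field_simps)
    \<comment> \<open>The constant term of \<open>eig_mat ev_min u v / ev_min\<close> is exactly
      \<open>- 1 / theta_value\<close>, cancelled by the extra coordinate.\<close>
    also have "\<dots> = of_bool (u = v) - adj G u v / ev_min"
      unfolding eig_mat_def theta_value_def using ev_min_neg n d_minus_ev_min_pos
      by (simp add: field_simps)
    finally show ?thesis .
  qed
  then have rep: "orthonormal_rep G (Suc N) U"
    unfolding orthonormal_rep_def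
    by (intro conjI ballI impI; (elim conjE)?) (simp_all add: U_carrier, simp add: adj_def)
  have c: "c \<in> carrier_vec (Suc N)" "scalar_prod c c = 1"
    by (simp_all add: c_def scalar_prod_def sum.atLeast0_lessThan_Suc_shift del: sum.op_ivl_Suc)
  have cu: "scalar_prod c (U u) = p" for u
    by (simp add: c_def U_def scalar_prod_def sum.atLeast0_lessThan_Suc_shift del: sum.op_ivl_Suc)
  have "(MAX i\<in>pverts G. 1 / ereal ((scalar_prod c (U i))\<^sup>2)) = (MAX i\<in>pverts G. ereal theta_value)"
    unfolding cu using p2 theta_value_pos by (simp add: power2_eq_square one_ereal_def)
  also have "\<dots> = ereal theta_value" using verts_nonempty by simp
  finally have "ereal theta_value \<in> {(MAX i\<in>pverts G. 1 / ereal ((scalar_prod c (u i))\<^sup>2)) | k c u.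
            c \<in> carrier_vec k \<and> scalar_prod c c = 1 \<and> orthonormal_rep G k u}"
    using rep c by (metis (mono_tags, lifting) mem_Collect_eq)
  then show ?thesis unfolding lovasz_theta_def by (rule Inf_lower)
qed

text \<open>The matrix equals \<open>eig_mat ev_max + g J\<close>. The first summand is a Gram
  matrix divided by \<open>ev_max - ev_min > 0\<close>, and \<open>g \<ge> 0\<close> because
  \<open>d - ev_max \<le> n\<close>; the form is thus a nonnegative combination of squares.\<close>

lemma dual_mat_psd:
  fixes z :: "'a \<Rightarrow> real"
  shows "0 \<le> (\<Sum>i\<in>pverts G. \<Sum>j\<in>pverts G. (ev_max * of_bool (i = j) - adj G i j + 1) * (z i * z j))"
proof -
  define g where "g = 1 - (real d - ev_max) / n"
  define D where "D = ev_max - ev_min"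
  have D: "D > 0" using ev_min_neg ev_max_nonneg by (simp add: D_def)
  have g: "g \<ge> 0" using params_le ev_max_nonneg by (simp add: g_def field_simps)
  have entry: "ev_max * of_bool (i = j) - adj G i j + 1
     = (\<Sum>k\<in>pverts G. eig_mat ev_max k i * eig_mat ev_max k j) / D + g"
    if "i \<in> pverts G" "j \<in> pverts G" for i j
    unfolding eig_mat_max_square[OF that] using D by (simp add: D_def eig_mat_def g_def)
  have "(\<Sum>i\<in>pverts G. \<Sum>j\<in>pverts G. (ev_max * of_bool (i = j) - adj G i j + 1) * (z i * z j))
     = (\<Sum>i\<in>pverts G. \<Sum>j\<in>pverts G.
          (\<Sum>k\<in>pverts G. (eig_mat ev_max k i * z i) * (eig_mat ev_max k j * z j)) / D + g * (z i * z j))"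
  proof (intro sum.cong refl)
    fix i j assume ij: "i \<in> pverts G" "j \<in> pverts G"
    have "(\<Sum>k\<in>pverts G. (eig_mat ev_max k i * z i) * (eig_mat ev_max k j * z j))
        = (\<Sum>k\<in>pverts G. eig_mat ev_max k i * eig_mat ev_max k j) * (z i * z j)"
      by (simp add: sum_distrib_left mult_ac)
    then show "(ev_max * of_bool (i = j) - adj G i j + 1) * (z i * z j)
        = (\<Sum>k\<in>pverts G. (eig_mat ev_max k i * z i) * (eig_mat ev_max k j * z j)) / D + g * (z i * z j)"
      by (simp only: entry[OF ij] distrib_right times_divide_eq_left)
  qed
  also have "\<dots> = (\<Sum>i\<in>pverts G. \<Sum>j\<in>pverts G. \<Sum>k\<in>pverts G. (eig_mat ev_max k i * z i) * (eig_mat ev_max k j * z j)) / D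
       + g * (\<Sum>i\<in>pverts G. \<Sum>j\<in>pverts G. z i * z j)"
    by (simp add: sum.distrib sum_divide_distrib sum_distrib_left)
  also have "(\<Sum>i\<in>pverts G. \<Sum>j\<in>pverts G. \<Sum>k\<in>pverts G. (eig_mat ev_max k i * z i) * (eig_mat ev_max k j * z j))
      = (\<Sum>i\<in>pverts G. \<Sum>k\<in>pverts G. \<Sum>j\<in>pverts G. (eig_mat ev_max k i * z i) * (eig_mat ev_max k j * z j))"
    by (intro sum.cong refl sum.swap)
  also have "\<dots> = (\<Sum>k\<in>pverts G. \<Sum>i\<in>pverts G. \<Sum>j\<in>pverts G. (eig_mat ev_max k i * z i) * (eig_mat ev_max k j * z j))"
    by (rule sum.swap)
  also have "\<dots> = (\<Sum>k\<in>pverts G. (\<Sum>i\<in>pverts G. eig_mat ev_max k i * z i)\<^sup>2)"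
    by (simp add: power2_eq_square sum_product)
  also have "(\<Sum>i\<in>pverts G. \<Sum>j\<in>pverts G. z i * z j) = (\<Sum>i\<in>pverts G. z i)\<^sup>2"
    by (simp add: power2_eq_square sum_product)
  also have "(\<Sum>k\<in>pverts G. (\<Sum>i\<in>pverts G. eig_mat ev_max k i * z i)\<^sup>2) / D + g * (\<Sum>i\<in>pverts G. z i)\<^sup>2 \<ge> 0"
    using D g by (intro add_nonneg_nonneg divide_nonneg_pos mult_nonneg_nonneg sum_nonneg) auto
  finally show ?thesis .
qed

text \<open>Apply \<open>dual_mat_psd\<close> to each coordinate of the vectors \<open>b c - (c \<bullet> u i) u i\<close> and add up; all
  off-diagonal terms \<open>u i \<bullet> u j\<close> disappear.\<close>

lemma sum_scalar_prod_squares_le: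
  assumes c: "c \<in> carrier_vec k" "scalar_prod c c = 1" and rep: "orthonormal_rep G k u"
  shows "(\<Sum>i\<in>pverts G. (scalar_prod c (u i))\<^sup>2) \<le> n / theta_value"
proof -
  define N where "N i j = ev_max * of_bool (i = j) - adj G i j + 1" for i j
  define x where "x i = scalar_prod c (u i)" for i
  define S where "S = (\<Sum>i\<in>pverts G. (x i)\<^sup>2)"
  define rho where "rho = real n - real d + ev_max"
  \<comment> \<open>This is \<open>1 / theta_value\<close> by \<open>theta_value_alt\<close>. Since
    \<open>b * rho = 1 + ev_max\<close>, all terms of the final inequality share the factor
    \<open>1 + ev_max\<close>.\<close>
  define b where "b = (1 + ev_max) / rho"
  have rho: "rho > 0" using params_le ev_max_nonneg by (simp add: rho_def)
  have brho: "b * rho = 1 + ev_max" using rho by (simp add: b_def)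
  have row: "(\<Sum>j\<in>pverts G. N i j) = rho" if "i \<in> pverts G" for i
  proof -
    have "(\<Sum>j\<in>pverts G. N i j) = (\<Sum>j\<in>pverts G. of_bool (i = j) * ev_max - adj G i j + 1)"
      by (simp add: N_def mult.commute)
    also have "\<dots> = rho"
      using that by (simp add: sum.distrib sum_subtractf sum_of_bool_eq sum_adj card_nbrs card_verts rho_def)
    finally show ?thesis .
  qed
  have N_sym: "N i j = N j i" for i j by (auto simp: N_def adj_sym)
  have dim: "dim_vec (u i) = k" if "i \<in> pverts G" for i
    using rep that by (auto simp: orthonormal_rep_def)
  have prod: "(\<Sum>t<k. (b * c $ t - x i * u i $ t) * (b * c $ t - x j * u j $ t))
      = b\<^sup>2 - b * (x i)\<^sup>2 - b * (x j)\<^sup>2 + x i * x j * scalar_prod (u i) (u j)"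
    if "i \<in> pverts G" "j \<in> pverts G" for i j
  proof -
    have cc: "(\<Sum>t<k. c $ t * c $ t) = 1" using c by (simp add: scalar_prod_def atLeast0LessThan)
    have cu: "(\<Sum>t<k. c $ t * u l $ t) = x l" if "l \<in> pverts G" for l
      using dim[OF that] by (simp add: x_def scalar_prod_def atLeast0LessThan)
    have uu: "(\<Sum>t<k. u i $ t * u j $ t) = scalar_prod (u i) (u j)"
      using dim[OF that(2)] by (simp add: scalar_prod_def atLeast0LessThan)
    have "(\<Sum>t<k. (b * c $ t - x i * u i $ t) * (b * c $ t - x j * u j $ t))
       = (\<Sum>t<k. b\<^sup>2 * (c $ t * c $ t) - b * x i * (c $ t * u i $ t) - b * x j * (c $ t * u j $ t)
            + x i * x j * (u i $ t * u j $ t))"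
      by (intro sum.cong refl) (simp add: power2_eq_square algebra_simps)
    also have "\<dots> = b\<^sup>2 * (\<Sum>t<k. c $ t * c $ t) - b * x i * (\<Sum>t<k. c $ t * u i $ t)
        - b * x j * (\<Sum>t<k. c $ t * u j $ t) + x i * x j * (\<Sum>t<k. u i $ t * u j $ t)"
      by (simp add: sum.distrib sum_subtractf sum_distrib_left)
    finally show ?thesis using that by (simp add: cc cu uu power2_eq_square)
  qed
  \<comment> \<open>\<open>N\<close> vanishes on arcs and the inner product on distinct nonadjacent
    pairs, so only the diagonal remains.\<close>
  have diag: "N i j * (x i * x j * scalar_prod (u i) (u j)) = of_bool (i = j) * ((1 + ev_max) * (x j)\<^sup>2)"
    if "i \<in> pverts G" "j \<in> pverts G" for i j
  proof (cases "i = j")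
    case True
    then show ?thesis using rep that by (simp add: orthonormal_rep_def N_def power2_eq_square)
  next
    case False
    then have "N i j * scalar_prod (u i) (u j) = 0"
      using rep that by (cases "(i, j) \<in> parcs G") (auto simp: orthonormal_rep_def N_def adj_def)
    then show ?thesis using False by auto
  qed
  have N_sum: "(\<Sum>i\<in>pverts G. \<Sum>j\<in>pverts G. N i j) = n * rho"
    by (simp add: row card_verts)
  have x_sum: "(\<Sum>i\<in>pverts G. (x i)\<^sup>2 * (\<Sum>j\<in>pverts G. N i j)) = rho * S"
    by (simp add: row S_def sum_distrib_left mult.commute)
  have "(\<Sum>i\<in>pverts G. \<Sum>j\<in>pverts G. (x j)\<^sup>2 * N i j) = (\<Sum>j\<in>pverts G. \<Sum>i\<in>pverts G. (x j)\<^sup>2 * N j i)"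
    by (subst sum.swap) (simp add: N_sym)
  then have x_sum': "(\<Sum>i\<in>pverts G. \<Sum>j\<in>pverts G. (x j)\<^sup>2 * N i j) = rho * S"
    using x_sum by (simp add: sum_distrib_left)
  have "0 \<le> (\<Sum>t<k. \<Sum>i\<in>pverts G. \<Sum>j\<in>pverts G.
      N i j * ((b * c $ t - x i * u i $ t) * (b * c $ t - x j * u j $ t)))"
    unfolding N_def by (intro sum_nonneg dual_mat_psd)
  also have "\<dots> = (\<Sum>i\<in>pverts G. \<Sum>t<k. \<Sum>j\<in>pverts G.
      N i j * ((b * c $ t - x i * u i $ t) * (b * c $ t - x j * u j $ t)))"
    by (rule sum.swap)
  also have "\<dots> = (\<Sum>i\<in>pverts G. \<Sum>j\<in>pverts G. \<Sum>t<k.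
      N i j * ((b * c $ t - x i * u i $ t) * (b * c $ t - x j * u j $ t)))"
    by (intro sum.cong refl sum.swap)
  also have "\<dots> = (\<Sum>i\<in>pverts G. \<Sum>j\<in>pverts G. b\<^sup>2 * N i j - b * ((x i)\<^sup>2 * N i j) - b * ((x j)\<^sup>2 * N i j)
      + of_bool (i = j) * ((1 + ev_max) * (x j)\<^sup>2))"
  proof (intro sum.cong refl)
    fix i j assume ij: "i \<in> pverts G" "j \<in> pverts G"
    have "(\<Sum>t<k. N i j * ((b * c $ t - x i * u i $ t) * (b * c $ t - x j * u j $ t)))
        = N i j * (b\<^sup>2 - b * (x i)\<^sup>2 - b * (x j)\<^sup>2 + x i * x j * scalar_prod (u i) (u j))"
      by (simp only: prod[OF ij] flip: sum_distrib_left)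
    also have "\<dots> = b\<^sup>2 * N i j - b * ((x i)\<^sup>2 * N i j) - b * ((x j)\<^sup>2 * N i j)
        + N i j * (x i * x j * scalar_prod (u i) (u j))"
      by (simp add: algebra_simps)
    finally show "(\<Sum>t<k. N i j * ((b * c $ t - x i * u i $ t) * (b * c $ t - x j * u j $ t)))
        = b\<^sup>2 * N i j - b * ((x i)\<^sup>2 * N i j) - b * ((x j)\<^sup>2 * N i j)
          + of_bool (i = j) * ((1 + ev_max) * (x j)\<^sup>2)"
      by (simp only: diag[OF ij])
  qed
  also have "\<dots> = b\<^sup>2 * (\<Sum>i\<in>pverts G. \<Sum>j\<in>pverts G. N i j)
      - b * (\<Sum>i\<in>pverts G. (x i)\<^sup>2 * (\<Sum>j\<in>pverts G. N i j))
      - b * (\<Sum>i\<in>pverts G. \<Sum>j\<in>pverts G. (x j)\<^sup>2 * N i j) + (1 + ev_max) * S"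
    by (simp add: sum.distrib sum_subtractf sum_of_bool_eq S_def flip: sum_distrib_left)
  also have "\<dots> = b\<^sup>2 * (n * rho) - b * (rho * S) - b * (rho * S) + (1 + ev_max) * S"
    by (simp only: N_sum x_sum x_sum')
  finally have "0 \<le> b\<^sup>2 * (n * rho) - b * (rho * S) - b * (rho * S) + (1 + ev_max) * S" .
  moreover have "b\<^sup>2 * (n * rho) - b * (rho * S) - b * (rho * S) + (1 + ev_max) * S
      = (b * rho) * (b * n) - 2 * (b * rho) * S + (1 + ev_max) * S"
    by (simp add: power2_eq_square algebra_simps)
  ultimately have "0 \<le> (1 + ev_max) * (b * n - S)"
    unfolding brho by (simp add: algebra_simps)
  then have "S \<le> b * n" using ev_max_nonneg by (simp add: zero_le_mult_iff)
  moreover have "b * n = n / theta_value" by (simp add: theta_value_alt b_def rho_def)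
  ultimately show ?thesis by (simp add: S_def x_def)
qed

text \<open>Averaging: the \<open>n\<close> squares sum to at most \<open>n / theta_value\<close>,
  so some vertex has a square of at most \<open>1 / theta_value\<close>, and its quotient bounds the
  maximum from below.\<close>

lemma le_lovasz_theta: "ereal theta_value \<le> lovasz_theta G"
  unfolding lovasz_theta_def
proof (rule Inf_greatest)
  fix t assume "t \<in> {(MAX i\<in>pverts G. 1 / ereal ((scalar_prod c (u i))\<^sup>2)) | k c u.
            c \<in> carrier_vec k \<and> scalar_prod c c = 1 \<and> orthonormal_rep G k u}"
  then obtain k c u where t: "t = (MAX i\<in>pverts G. 1 / ereal ((scalar_prod c (u i))\<^sup>2))"
    and c: "c \<in> carrier_vec k" "scalar_prod c c = 1" and rep: "orthonormal_rep G k u"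
    by blast
  have "\<exists>i\<in>pverts G. (scalar_prod c (u i))\<^sup>2 \<le> 1 / theta_value"
  proof (rule ccontr)
    assume "\<not> ?thesis"
    then have "(\<Sum>i\<in>pverts G. 1 / theta_value) < (\<Sum>i\<in>pverts G. (scalar_prod c (u i))\<^sup>2)"
      using verts_nonempty by (intro sum_strict_mono) auto
    then show False using sum_scalar_prod_squares_le[OF c rep] by (simp add: card_verts)
  qed
  then obtain i where i: "i \<in> pverts G" and le: "(scalar_prod c (u i))\<^sup>2 \<le> 1 / theta_value" by blast
  have "ereal theta_value \<le> 1 / ereal ((scalar_prod c (u i))\<^sup>2)"
  proof (cases "scalar_prod c (u i) = 0")
    case False
    then have "theta_value \<le> 1 / (scalar_prod c (u i))\<^sup>2"
      using le theta_value_pos by (simp add: field_simps)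
    then show ?thesis using False by (simp add: one_ereal_def)
  next
    \<comment> \<open>Here \<open>c\<close> is orthogonal to \<open>u i\<close>, and the quotient is
      \<open>1 / 0 = \<infinity>\<close> in \<open>ereal\<close>.\<close>
    case True
    then show ?thesis by (simp add: divide_ereal_def flip: zero_ereal_def)
  qed
  also have "\<dots> \<le> t" unfolding t using i by (intro Max_ge) auto
  finally show "ereal theta_value \<le> t" .
qed

lemma lovasz_theta_eq: "lovasz_theta G = ereal theta_value"
  using lovasz_theta_le le_lovasz_theta by (rule antisym)

end

theorem theorem2p4p43:
  fixes G :: "'a pair_pre_digraph" and H :: "'b pair_pre_digraph"
    and n d lam mu :: nat
  assumes "pair_graph G"
    and "Digraph_Component.connected (with_proj G)"
    and "strongly_regular G n d lam mu"
    and "pair_graph H"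
    and "adj_spectrum H = adj_spectrum G"
  shows "strongly_regular H n d lam mu \<and>
         lovasz_theta H = lovasz_theta G \<and>
         num_edges H = num_edges G \<and>
         num_triangles H = num_triangles G \<and>
         girth H = girth G \<and>
         diam H = diam G"
proof -
  interpret G: srg G n d lam mu
    using assms by (simp add: srg_def srg_axioms_def)
  have H: "strongly_regular H n d lam mu"
    using G.srg_axioms assms(4,5) by (rule strongly_regular_cospectral)
  interpret H: srg H n d lam mu
    using assms(4) H by (simp add: srg_def srg_axioms_def)
  \<comment> \<open>Connectedness of \<open>G\<close> enters here, as a condition on the parameters
    alone, which \<open>H\<close> shares.\<close>
  have mu: "mu > 0" using G.connected_imp_mu_pos assms(2) .
  \<comment> \<open>The two locale instances have separate constants; unfolding reduces both to the
    same expression in the parameters.\<close>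
  have "H.theta_value = G.theta_value"
    by (simp add: G.theta_value_def H.theta_value_def G.ev_min_def H.ev_min_def G.disc_def H.disc_def)
  then show ?thesis
    using H G.lovasz_theta_eq H.lovasz_theta_eq G.num_edges_eq H.num_edges_eq
      G.num_triangles_eq H.num_triangles_eq G.girth_eq[OF mu] H.girth_eq[OF mu]
      G.diam_eq[OF mu] H.diam_eq[OF mu] by simp
qed

end
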